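(* Let $\alpha\in(0,1)$ be fixed, let $(\theta_n)_{n\in\mathbb N}$ with $\theta_n\in\mathbb R^n$ be arbitrary, and suppose that $\log|\mathcal C_n|=o(n)$. Then, as $n\to\infty$, $$\max_{C\in\hat{\mathcal K}_{n,\alpha}}R_n(C)\ \le\ \min_{D\in\mathcal C_n}R_n(D)+O_p\Bigl(\sqrt{\sigma^2\log(|\mathcal C_n|)\min_{D\in\mathcal C_n}R_n(D)}\Bigr)+O_p\bigl(\sigma^2\log|\mathcal C_n|\bigr)$$ and $$\max_{C\in\hat{\mathcal K}_{n,\alpha}}L_n(C)\ \le\ \min_{D\in\mathcal C_n}L_n(D)+O_p\Bigl(\sqrt{\sigma^2\log(|\mathcal C_n|)\min_{D\in\mathcal C_n}L_n(D)}\Bigr)+O_p\bigl(\sigma^2\log|\mathcal C_n|\bigr).$$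
   Context: **Model.** One observes $X_n=(X_{in})_{i=1}^n=\theta_n+\varepsilon_n$ with unknown $\theta_n\in\mathbb R^n$ and $\varepsilon_n\sim\mathcal N_n(0,\sigma^2I_n)$, where $\sigma>0$ is known. **Candidates.** $\mathcal C_n$ is a (nonempty) family of index sets $C\subset\{1,\dots,n\}$, with candidate estimators $\check\theta^{(C)}:=(1\{i\in C\}X_{in})_{i=1}^n$, losses $L_n(C):=\|\check\theta^{(C)}-\theta_n\|^2$ (Euclidean norm) and risks $$R_n(C):=\mathbb E L_n(C)=\sum_{i\notin C}\theta_{in}^2+|C|\sigma^2,$$ where $|S|$ denotes the cardinality of a set $S$. **Confidence bounds.** Let $\mathcal M_n:=\{D\setminus C:C,D\in\mathcal C_n\}$ and $M_n:=|\mathcal M_n|-1$ (the number of nonvoid sets in $\mathcal M_n$). For $J\subset\{1,\dots,n\}$ let $T_n(J):=\sigma^{-2}\sum_{i\in J}X_{in}^2$. Let $F_k(\cdot\mid\delta^2)$ be the distribution function of the noncentral chi-squared distribution $\chi^2_k(\delta^2)$ with $k$ degrees of freedom and noncentrality parameter $\delta^2$. Set $\hat\delta^2_{n,\alpha,l}(\emptyset):=\hat\delta^2_{n,\alpha,u}(\emptyset):=0$, and for nonvoid $J\in\mathcal M_n$, $$\hat\delta^2_{n,\alpha,l}(J):=\min\bigl\{\delta^2\ge0:F_{|J|}(T_n(J)\mid\delta^2)\le1-\alpha/(2M_n)\bigr\},$$ $$\hat\delta^2_{n,\alpha,u}(J):=\max\bigl\{\delta^2\ge0:F_{|J|}(T_n(J)\mid\delta^2)\ge\alpha/(2M_n)\bigr\},$$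 with the convention that the latter maximum is $0$ if the set is empty. **Confidence region** (for $\operatorname{argmin}_{C\in\mathcal C_n}R_n(C)$): $$\hat{\mathcal K}_{n,\alpha}:=\bigl\{C\in\mathcal C_n:\hat\delta^2_{n,\alpha,u}(C\setminus D)-\hat\delta^2_{n,\alpha,l}(D\setminus C)+|D|-|C|\ge0\ \text{ for all }D\in\mathcal C_n\bigr\}.$$ A maximum over $\hat{\mathcal K}_{n,\alpha}$ imposes no condition when $\hat{\mathcal K}_{n,\alpha}$ is empty. $O_p(r_n)$ denotes a random variable depending on $n$ that is bounded in probability after division by $r_n$, as $n\to\infty$. *)

theory Defs
  imports "HOL-Probability.Probability" "HOL-Library.Landau_Symbols"
begin

text \<open>Vectors in Euclidean n-space are functions on \<^term>\<open>{1..n::nat}\<close>; values outside this index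
  set never matter.\<close>

definition cand_est :: "nat set \<Rightarrow> (nat \<Rightarrow> real) \<Rightarrow> nat \<Rightarrow> real" where
  "cand_est C x i = (if i \<in> C then x i else 0)"

definition loss :: "nat \<Rightarrow> (nat \<Rightarrow> real) \<Rightarrow> (nat \<Rightarrow> real) \<Rightarrow> nat set \<Rightarrow> real" where
  "loss n \<theta> x C = (L2_set (\<lambda>i. cand_est C x i - \<theta> i) {1..n})\<^sup>2"

definition risk :: "'a measure \<Rightarrow> nat \<Rightarrow> (nat \<Rightarrow> real) \<Rightarrow> (nat \<Rightarrow> 'a \<Rightarrow> real) \<Rightarrow> nat set \<Rightarrow> real" where
  "risk M n \<theta> X C = (\<integral>\<omega>. loss n \<theta> (\<lambda>i. X i \<omega>) C \<partial>M)"

text \<open>The family of set differences always contains the empty set when \<^term>\<open>\<C>\<close> is nonempty, so the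
  natural-number subtraction in \<open>num_diff\<close> does not truncate.\<close>

definition diff_sets :: "nat set set \<Rightarrow> nat set set" where
  "diff_sets \<C> = {D - C | C D. C \<in> \<C> \<and> D \<in> \<C>}"

definition num_diff :: "nat set set \<Rightarrow> nat" where
  "num_diff \<C> = card (diff_sets \<C>) - 1"

definition T_stat :: "real \<Rightarrow> (nat \<Rightarrow> real) \<Rightarrow> nat set \<Rightarrow> real" where
  "T_stat \<sigma> x J = (\<Sum>i\<in>J. (x i)\<^sup>2) / \<sigma>\<^sup>2"

text \<open>For \<open>k \<ge> 1\<close> and \<open>d \<ge> 0\<close>, the noncentral chi-squared distribution with \<open>k\<close> degrees of freedom and
  noncentrality parameter \<open>d\<close> is the law of the squared norm of a standard Gaussian vector in
  dimension \<open>k\<close> shifted by a vector of squared norm \<open>d\<close>. By rotation invariance the direction of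
  the shift is irrelevant; it is taken along the first coordinate.\<close>

definition noncentral_chi_squared :: "nat \<Rightarrow> real \<Rightarrow> real measure" where
  "noncentral_chi_squared k d =
     distr (\<Pi>\<^sub>M i\<in>{..<k}. density lborel (\<lambda>x. ennreal (std_normal_density x))) borel
       (\<lambda>z. \<Sum>i<k. (z i + (if i = 0 then sqrt d else 0))\<^sup>2)"

definition delta2_lower :: "real \<Rightarrow> real \<Rightarrow> nat set set \<Rightarrow> (nat \<Rightarrow> real) \<Rightarrow> nat set \<Rightarrow> real" where
  "delta2_lower \<alpha> \<sigma> \<C> x J =
     (if J = {} then 0
      else LEAST d. 0 \<le> d \<and>
        cdf (noncentral_chi_squared (card J) d) (T_stat \<sigma> x J) \<le> 1 - \<alpha> / (2 * real (num_diff \<C>)))"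

definition delta2_upper :: "real \<Rightarrow> real \<Rightarrow> nat set set \<Rightarrow> (nat \<Rightarrow> real) \<Rightarrow> nat set \<Rightarrow> real" where
  "delta2_upper \<alpha> \<sigma> \<C> x J =
     (let P = (\<lambda>d. 0 \<le> d \<and>
        \<alpha> / (2 * real (num_diff \<C>)) \<le> cdf (noncentral_chi_squared (card J) d) (T_stat \<sigma> x J))
      in if J = {} \<or> (\<nexists>d. P d) then 0 else (GREATEST d. P d))"

definition conf_region :: "real \<Rightarrow> real \<Rightarrow> nat set set \<Rightarrow> (nat \<Rightarrow> real) \<Rightarrow> nat set set" where
  "conf_region \<alpha> \<sigma> \<C> x =
     {C \<in> \<C>. \<forall>D\<in>\<C>. delta2_upper \<alpha> \<sigma> \<C> x (C - D) - delta2_lower \<alpha> \<sigma> \<C> x (D - C)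
                      + real (card D) - real (card C) \<ge> 0}"

text \<open>\<open>big_Op M U r\<close>: the sequence \<open>U\<close> of random variables on the probability spaces \<open>M n\<close> is
  \<open>O\<^sub>p(r\<^sub>n)\<close>, where the rate may itself be random. The bound is written multiplicatively, because
  Isabelle's \<open>x / 0 = 0\<close> would make \<open>O\<^sub>p(0)\<close> vacuous; here it forces \<open>U\<close> to vanish with probability
  tending to one. Measurability is part of the notion, since the measure of a nonmeasurable set
  is zero by convention.\<close>

definition big_Op :: "(nat \<Rightarrow> 'a measure) \<Rightarrow> (nat \<Rightarrow> 'a \<Rightarrow> real) \<Rightarrow> (nat \<Rightarrow> 'a \<Rightarrow> real) \<Rightarrow> bool" where
  "big_Op M U r \<longleftrightarrow>
     (\<forall>n. U n \<in> borel_measurable (M n) \<and> r n \<in> borel_measurable (M n)) \<and>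
     (\<forall>e>0. \<exists>K. \<forall>\<^sub>F n in sequentially.
        measure (M n) {\<omega> \<in> space (M n). \<bar>U n \<omega>\<bar> > K * \<bar>r n \<omega>\<bar>} < e)"

end

theory Submission
  imports Defs
begin

text \<open>
  A sum of squares of independent shifted standard normal variables has centre \<open>v\<close>, the number of
  summands plus the noncentrality, and Chernoff's bound shows that it deviates from \<open>v\<close> by more than
  \<open>4 * sqrt (v * L) + 4 * L\<close> in a given direction with probability at most \<open>exp (- L)\<close>. Applied to the
  noncentral chi-squared distributions this locates the confidence bounds in terms of the observed
  statistics; applied to the data, simultaneously over all set differences, it locates these statistics
  in terms of the true noncentralities. Hence if \<open>C\<close> is in the confidence region, then for every
  candidate \<open>D\<close> the difference of the (rescaled) risks is at most a constant times
  \<open>sqrt (v\<^sub>1 * L) + sqrt (v\<^sub>2 * L) + L\<close>, where \<open>v\<^sub>1\<close> and \<open>v\<^sub>2\<close> belong to \<open>C - D\<close> and \<open>D - C\<close> and are bounded by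
  the sum of the two risks. Solving this quadratic inequality for the risk of \<open>C\<close> gives the oracle
  bound with \<open>L\<close> of the order of \<open>ln (card \<C>)\<close>. The losses are handled alike, by the concentration of
  the central sums of squares.
\<close>

section \<open>Concentration of sums of shifted squares\<close>

text \<open>Completing the square turns the tilted Gaussian into a multiple of a normal density with
  variance \<open>s\<^sup>2\<close>, whose total mass is 1. The bound on \<open>l\<close> keeps that
  variance positive and finite.\<close>

lemma nn_integral_exp_square_std_normal:
  fixes l a :: real
  assumes "l < 1 / 2"
  shows "(\<integral>\<^sup>+x. ennreal (std_normal_density x) * ennreal (exp (l * (x + a)\<^sup>2)) \<partial>lborel)
    = ennreal (exp (l * a\<^sup>2 / (1 - 2 * l)) / sqrt (1 - 2 * l))"
proof -
  define s where "s = 1 / sqrt (1 - 2 * l)"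
  have pos: "1 - 2 * l > 0" using assms by simp
  have s: "s > 0" using pos by (simp add: s_def)
  have s2: "s\<^sup>2 = 1 / (1 - 2 * l)" using pos by (simp add: s_def power_divide)
  define m where "m = 2 * l * a * s\<^sup>2"
  have eq: "std_normal_density x * exp (l * (x + a)\<^sup>2)
      = exp (l * a\<^sup>2 * s\<^sup>2) * s * normal_density m s x" for x
  proof -
    have "- (x\<^sup>2 / 2) + l * (x + a)\<^sup>2 = l * a\<^sup>2 * s\<^sup>2 - (x - m)\<^sup>2 / (2 * s\<^sup>2)"
      unfolding m_def s2 using pos by (simp add: divide_simps) (simp add: power2_eq_square algebra_simps)
    hence "exp (- (x\<^sup>2 / 2)) * exp (l * (x + a)\<^sup>2) = exp (l * a\<^sup>2 * s\<^sup>2) * exp (- ((x - m)\<^sup>2 / (2 * s\<^sup>2)))"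
      by (simp add: exp_add[symmetric])
    thus ?thesis using s by (simp add: normal_density_def real_sqrt_mult)
  qed
  have "(\<integral>\<^sup>+x. ennreal (std_normal_density x) * ennreal (exp (l * (x + a)\<^sup>2)) \<partial>lborel)
      = (\<integral>\<^sup>+x. ennreal (exp (l * a\<^sup>2 * s\<^sup>2) * s) * ennreal (normal_density m s x) \<partial>lborel)"
    using s by (intro nn_integral_cong) (simp add: ennreal_mult[symmetric] eq)
  also have "\<dots> = ennreal (exp (l * a\<^sup>2 * s\<^sup>2) * s) * (\<integral>\<^sup>+x. ennreal (normal_density m s x) \<partial>lborel)"
    by (rule nn_integral_cmult) simp
  also have "(\<integral>\<^sup>+x. ennreal (normal_density m s x) \<partial>lborel) = 1"
    using prob_space.emeasure_space_1[OF prob_space_normal_density[OF s]]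
    by (simp add: emeasure_density)
  finally show ?thesis by (simp add: s2) (simp add: s_def)
qed

text \<open>The coefficient linear in \<open>l\<close> is the mean \<open>1 + a\<^sup>2\<close> of
  the shifted square. Since \<open>\<bar>2 * l\<bar> \<le> 1 / 2\<close>, the second-order
  remainders of the logarithm and of \<open>l / (1 - 2 * l)\<close> are each at most
  \<open>4 * l\<^sup>2\<close>.\<close>

lemma exp_square_std_normal_bound:
  fixes l a :: real
  assumes "\<bar>l\<bar> \<le> 1 / 4"
  shows "exp (l * a\<^sup>2 / (1 - 2 * l)) / sqrt (1 - 2 * l) \<le> exp ((l + 4 * l\<^sup>2) * (1 + a\<^sup>2))"
proof -
  have pos: "1 - 2 * l \<ge> 1 / 2" using assms by linarith
  have "\<bar>ln (1 + (- 2 * l)) - (- 2 * l)\<bar> \<le> 2 * (- 2 * l)\<^sup>2"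
    using assms by (intro abs_ln_one_plus_x_minus_x_bound) simp
  hence ln: "- (ln (1 - 2 * l) / 2) \<le> l + 4 * l\<^sup>2" by (simp add: power2_eq_square)
  have "sqrt (1 - 2 * l) = exp (ln (1 - 2 * l) / 2)"
    using pos by (simp add: ln_sqrt[symmetric])
  hence 1: "1 / sqrt (1 - 2 * l) \<le> exp (l + 4 * l\<^sup>2)"
    using ln by (simp add: exp_minus[symmetric] inverse_eq_divide[symmetric])
  have "l / (1 - 2 * l) = l + 2 * l\<^sup>2 / (1 - 2 * l)"
    using pos by (simp add: field_simps power2_eq_square)
  also have "2 * l\<^sup>2 / (1 - 2 * l) \<le> 2 * l\<^sup>2 / (1 / 2)"
    using pos by (intro divide_left_mono) auto
  finally have "l / (1 - 2 * l) \<le> l + 4 * l\<^sup>2" by simp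
  from mult_right_mono[OF this, of "a\<^sup>2"]
  have 2: "exp (l * a\<^sup>2 / (1 - 2 * l)) \<le> exp ((l + 4 * l\<^sup>2) * a\<^sup>2)" by simp
  have "exp (l * a\<^sup>2 / (1 - 2 * l)) * (1 / sqrt (1 - 2 * l))
      \<le> exp ((l + 4 * l\<^sup>2) * a\<^sup>2) * exp (l + 4 * l\<^sup>2)"
    using 1 2 pos by (intro mult_mono) auto
  thus ?thesis by (simp add: exp_add[symmetric] algebra_simps)
qed

text \<open>The threshold beyond which a sum of shifted squares with centre \<open>v\<close> falls with probability at
  most \<open>exp (- L)\<close>: some \<open>l \<in> (0, 1/4]\<close> satisfies \<open>4 * l\<^sup>2 * v - l * dev v L \<le> - L\<close>.\<close>

definition dev :: "real \<Rightarrow> real \<Rightarrow> real" where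
  "dev v L = 4 * sqrt (v * L) + 4 * L"

lemma (in prob_space) nn_integral_exp_shifted_squares:
  fixes Z :: "'i \<Rightarrow> 'a \<Rightarrow> real" and a :: "'i \<Rightarrow> real"
  assumes J: "finite J" and indep: "indep_vars (\<lambda>_. borel) Z J"
    and Z: "\<And>i. i \<in> J \<Longrightarrow> distributed M lborel (Z i) std_normal_density"
    and l: "\<bar>l\<bar> \<le> 1 / 4"
  defines "v \<equiv> real (card J) + (\<Sum>i\<in>J. (a i)\<^sup>2)"
  shows "(\<integral>\<^sup>+\<omega>. ennreal (exp (l * ((\<Sum>i\<in>J. (Z i \<omega> + a i)\<^sup>2) - v))) \<partial>M) \<le> ennreal (exp (4 * l\<^sup>2 * v))"
proof -
  have meas[measurable]: "Z i \<in> borel_measurable M" if "i \<in> J" for i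
    using distributed_measurable[OF Z[OF that]] by simp
  have "(\<integral>\<^sup>+\<omega>. ennreal (exp (l * ((\<Sum>i\<in>J. (Z i \<omega> + a i)\<^sup>2) - v))) \<partial>M)
      = (\<integral>\<^sup>+\<omega>. ennreal (exp (- (l * v))) * (\<Prod>i\<in>J. ennreal (exp (l * (Z i \<omega> + a i)\<^sup>2))) \<partial>M)"
    by (intro nn_integral_cong)
      (simp add: prod_ennreal ennreal_mult[symmetric] prod_nonneg exp_sum[symmetric] J exp_add[symmetric]
        sum_distrib_left algebra_simps)
  also have "\<dots> = ennreal (exp (- (l * v))) * (\<integral>\<^sup>+\<omega>. (\<Prod>i\<in>J. ennreal (exp (l * (Z i \<omega> + a i)\<^sup>2))) \<partial>M)"
    by (rule nn_integral_cmult) measurable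
  also have "(\<integral>\<^sup>+\<omega>. (\<Prod>i\<in>J. ennreal (exp (l * (Z i \<omega> + a i)\<^sup>2))) \<partial>M)
      = (\<Prod>i\<in>J. \<integral>\<^sup>+\<omega>. ennreal (exp (l * (Z i \<omega> + a i)\<^sup>2)) \<partial>M)"
    by (intro indep_vars_nn_integral J indep_vars_compose2[OF indep]) auto
  also have "\<dots> \<le> (\<Prod>i\<in>J. ennreal (exp ((l + 4 * l\<^sup>2) * (1 + (a i)\<^sup>2))))"
  proof (intro prod_mono_ennreal)
    fix i assume i: "i \<in> J"
    have "(\<integral>\<^sup>+\<omega>. ennreal (exp (l * (Z i \<omega> + a i)\<^sup>2)) \<partial>M)
        = (\<integral>\<^sup>+x. ennreal (std_normal_density x) * ennreal (exp (l * (x + a i)\<^sup>2)) \<partial>lborel)"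
      using distributed_nn_integral[OF Z[OF i], of "\<lambda>x. ennreal (exp (l * (x + a i)\<^sup>2))"] by simp
    also have "\<dots> = ennreal (exp (l * (a i)\<^sup>2 / (1 - 2 * l)) / sqrt (1 - 2 * l))"
      using l by (intro nn_integral_exp_square_std_normal) linarith
    also have "\<dots> \<le> ennreal (exp ((l + 4 * l\<^sup>2) * (1 + (a i)\<^sup>2)))"
      using exp_square_std_normal_bound[OF l] by (intro ennreal_leI)
    finally show "(\<integral>\<^sup>+\<omega>. ennreal (exp (l * (Z i \<omega> + a i)\<^sup>2)) \<partial>M) \<le> ennreal (exp ((l + 4 * l\<^sup>2) * (1 + (a i)\<^sup>2)))" .
  qed
  also have "\<dots> = ennreal (exp ((l + 4 * l\<^sup>2) * v))"
    by (simp add: prod_ennreal exp_sum[symmetric] J v_def sum_distrib_left[symmetric] sum.distrib)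
  also have "ennreal (exp (- (l * v))) * \<dots> = ennreal (exp (4 * l\<^sup>2 * v))"
    by (simp add: ennreal_mult[symmetric] exp_add[symmetric] algebra_simps)
  finally show ?thesis by (simp add: mult_left_mono)
qed

text \<open>For \<open>L \<le> v / 4\<close> the choice of \<open>l\<close> minimises the quadratic
  with the part \<open>4 * L\<close> of \<open>dev\<close> ignored. It reaches 1/4 at
  \<open>L = v / 4\<close>, and beyond that point \<open>l\<close> stays at this endpoint.\<close>

lemma dev_exponent:
  fixes v L :: real
  assumes "v \<ge> 0" "L > 0"
  obtains l where "0 < l" "l \<le> 1 / 4" "- l * dev v L + 4 * l\<^sup>2 * v \<le> - L"
proof (cases "L \<le> v / 4")
  case True
  define l where "l = sqrt (L / v) / 2"
  have v: "v > 0" using True assms by linarith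
  have "L / v \<le> (1 / 2)\<^sup>2" using True v by (simp add: field_simps power2_eq_square)
  hence "sqrt (L / v) \<le> 1 / 2" by (intro real_le_lsqrt) auto
  moreover have l: "l > 0" using assms v by (simp add: l_def)
  moreover have "- l * dev v L + 4 * l\<^sup>2 * v \<le> - L"
  proof -
    have "l * sqrt (v * L) = L / 2"
      using assms v by (simp add: l_def real_sqrt_mult[symmetric] power2_eq_square[symmetric])
    hence 1: "l * dev v L = 2 * L + 4 * (l * L)" by (simp add: dev_def algebra_simps)
    have 2: "l\<^sup>2 * v = L / 4" using assms v by (simp add: l_def power_divide)
    have 3: "l * L > 0" using l assms by simp
    have "- l * dev v L + 4 * l\<^sup>2 * v = - (l * dev v L) + 4 * (l\<^sup>2 * v)" by simp
    also have "\<dots> \<le> - L" unfolding 1 2 using 3 assms by linarith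
    finally show ?thesis .
  qed
  ultimately show ?thesis
    by (intro that[of l]) (simp_all add: l_def)
next
  case False
  have "v * (v / 4) \<le> v * L" using False assms by (intro mult_left_mono) auto
  hence "(v / 2)\<^sup>2 \<le> v * L" by (simp add: power2_eq_square)
  hence "v / 2 \<le> sqrt (v * L)" by (rule real_le_rsqrt)
  moreover have "sqrt (v * L) \<ge> 0" using assms by simp
  ultimately show ?thesis using assms by (intro that[of "1/4"]) (simp_all add: dev_def power2_eq_square add_divide_distrib)
qed

text \<open>Chernoff's bound with exponent \<open>l * sg\<close>: the sign selects the tail and
  disappears from the bound because only its square enters.\<close>

lemma (in prob_space) shifted_squares_tail:
  fixes Z :: "'i \<Rightarrow> 'a \<Rightarrow> real" and a :: "'i \<Rightarrow> real"
  assumes J: "finite J" and indep: "indep_vars (\<lambda>_. borel) Z J"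
    and Z: "\<And>i. i \<in> J \<Longrightarrow> distributed M lborel (Z i) std_normal_density"
    and L: "L > 0" and sg: "\<bar>sg\<bar> = 1"
  defines "v \<equiv> real (card J) + (\<Sum>i\<in>J. (a i)\<^sup>2)"
  shows "prob {\<omega>\<in>space M. sg * ((\<Sum>i\<in>J. (Z i \<omega> + a i)\<^sup>2) - v) \<ge> dev v L} \<le> exp (- L)"
proof -
  have meas[measurable]: "Z i \<in> borel_measurable M" if "i \<in> J" for i
    using distributed_measurable[OF Z[OF that]] by simp
  have "v \<ge> 0" by (simp add: v_def sum_nonneg)
  then obtain l where l: "0 < l" "l \<le> 1 / 4" "- l * dev v L + 4 * l\<^sup>2 * v \<le> - L"
    using dev_exponent L by blast
  have sg2: "sg\<^sup>2 = 1" using sg by (metis power2_abs one_power2)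
  let ?f = "\<lambda>\<omega>. sg * ((\<Sum>i\<in>J. (Z i \<omega> + a i)\<^sup>2) - v)"
  have "emeasure M {\<omega>\<in>space M. ?f \<omega> \<ge> dev v L}
      \<le> ennreal (exp (- l * dev v L)) * (\<integral>\<^sup>+\<omega>. ennreal (exp (l * ?f \<omega>)) * indicator (space M) \<omega> \<partial>M)"
    by (intro Chernoff_ineq_nn_integral_ge l) auto
  also have "(\<integral>\<^sup>+\<omega>. ennreal (exp (l * ?f \<omega>)) * indicator (space M) \<omega> \<partial>M)
      = (\<integral>\<^sup>+\<omega>. ennreal (exp ((l * sg) * ((\<Sum>i\<in>J. (Z i \<omega> + a i)\<^sup>2) - v))) \<partial>M)"
    by (intro nn_integral_cong) (simp add: mult.assoc)
  also have "\<dots> \<le> ennreal (exp (4 * (l * sg)\<^sup>2 * v))"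
    unfolding v_def using l sg by (intro nn_integral_exp_shifted_squares J indep Z) (auto simp: abs_mult)
  also have "ennreal (exp (- l * dev v L)) * \<dots> = ennreal (exp (- l * dev v L + 4 * l\<^sup>2 * v))"
    by (simp add: ennreal_mult[symmetric] exp_add[symmetric] power_mult_distrib sg2)
  also have "\<dots> \<le> ennreal (exp (- L))" using l by (intro ennreal_leI) simp
  finally show ?thesis by (simp add: emeasure_eq_measure mult_left_mono)
qed

lemma (in prob_space) shifted_squares_concentration:
  fixes Z :: "'i \<Rightarrow> 'a \<Rightarrow> real" and a :: "'i \<Rightarrow> real"
  assumes J: "finite J" and indep: "indep_vars (\<lambda>_. borel) Z J"
    and Z: "\<And>i. i \<in> J \<Longrightarrow> distributed M lborel (Z i) std_normal_density"
    and L: "L > 0"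
  defines "v \<equiv> real (card J) + (\<Sum>i\<in>J. (a i)\<^sup>2)"
  shows "prob {\<omega>\<in>space M. \<bar>(\<Sum>i\<in>J. (Z i \<omega> + a i)\<^sup>2) - v\<bar> \<ge> dev v L} \<le> 2 * exp (- L)"
proof -
  have meas[measurable]: "Z i \<in> borel_measurable M" if "i \<in> J" for i
    using distributed_measurable[OF Z[OF that]] by simp
  let ?A = "\<lambda>sg. {\<omega>\<in>space M. sg * ((\<Sum>i\<in>J. (Z i \<omega> + a i)\<^sup>2) - v) \<ge> dev v L}"
  have B: "prob (?A sg) \<le> exp (- L)" if "\<bar>sg\<bar> = 1" for sg
    unfolding v_def using that by (intro shifted_squares_tail[where a = a] J indep Z L)
  have "{\<omega>\<in>space M. \<bar>(\<Sum>i\<in>J. (Z i \<omega> + a i)\<^sup>2) - v\<bar> \<ge> dev v L} = ?A 1 \<union> ?A (- 1)" by auto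
  hence "prob {\<omega>\<in>space M. \<bar>(\<Sum>i\<in>J. (Z i \<omega> + a i)\<^sup>2) - v\<bar> \<ge> dev v L} = prob (?A 1 \<union> ?A (- 1))"
    by (rule arg_cong)
  also have "\<dots> \<le> prob (?A 1) + prob (?A (- 1))"
    by (intro measure_Un_le) measurable
  also have "\<dots> \<le> exp (- L) + exp (- L)"
    by (rule add_mono; rule B; simp)
  finally show ?thesis by simp
qed

section \<open>Noncentral chi-squared distributions\<close>

abbreviation std_normal :: "real measure" where
  "std_normal \<equiv> density lborel (\<lambda>x. ennreal (std_normal_density x))"

abbreviation std_normal_vec :: "nat \<Rightarrow> (nat \<Rightarrow> real) measure" where
  "std_normal_vec k \<equiv> \<Pi>\<^sub>M i\<in>{..<k}. std_normal"

abbreviation nc_shift :: "real \<Rightarrow> nat \<Rightarrow> real" where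
  "nc_shift d i \<equiv> (if i = 0 then sqrt d else 0)"

lemma prob_space_std_normal_vec: "prob_space (std_normal_vec k)"
  by (rule prob_space_PiM, rule prob_space_normal_density, simp)

lemma measurable_std_normal_vec_component:
  assumes "i < k"
  shows "(\<lambda>z. z i) \<in> borel_measurable (std_normal_vec k)"
proof -
  have "(\<lambda>z. z i) \<in> measurable (std_normal_vec k) std_normal"
    using assms by (intro measurable_component_singleton) auto
  thus ?thesis by (simp cong: measurable_cong_sets)
qed

lemma distr_std_normal_vec_component:
  assumes "i < k" "sets N = sets borel"
  shows "distr (std_normal_vec k) N (\<lambda>z. z i) = std_normal"
proof -
  have "distr (std_normal_vec k) N (\<lambda>z. z i) = distr (std_normal_vec k) std_normal (\<lambda>z. z i)"
    using assms(2) by (intro distr_cong) auto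
  also have "\<dots> = std_normal"
    using assms by (intro distr_PiM_component[of "{..<k}" "\<lambda>_. std_normal" i] prob_space_normal_density) auto
  finally show ?thesis .
qed

text \<open>The joint law of the coordinates is the product of their marginals; the criterion used
  asks for a nonempty index set.\<close>

lemma indep_vars_std_normal_vec:
  assumes "k > 0"
  shows "prob_space.indep_vars (std_normal_vec k) (\<lambda>_. borel) (\<lambda>i z. z i) {..<k}"
proof -
  interpret P: prob_space "std_normal_vec k" by (rule prob_space_std_normal_vec)
  have "distr (std_normal_vec k) (\<Pi>\<^sub>M i\<in>{..<k}. borel) (\<lambda>z. \<lambda>i\<in>{..<k}. z i)
      = distr (std_normal_vec k) (std_normal_vec k) (\<lambda>z. z)"
    by (intro distr_cong sets_PiM_cong) (auto simp: space_PiM)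
  also have "\<dots> = std_normal_vec k" by simp
  also have "\<dots> = (\<Pi>\<^sub>M i\<in>{..<k}. distr (std_normal_vec k) borel (\<lambda>z. z i))"
    by (intro PiM_cong) (auto simp: distr_std_normal_vec_component)
  finally show ?thesis
    using assms by (subst P.indep_vars_iff_distr_eq_PiM') (auto intro: measurable_std_normal_vec_component)
qed

lemma distributed_std_normal_vec_component:
  "i < k \<Longrightarrow> distributed (std_normal_vec k) lborel (\<lambda>z. z i) std_normal_density"
  using measurable_std_normal_vec_component[of i k]
  by (auto simp: distributed_def distr_std_normal_vec_component)

lemma nc_sum_measurable [measurable]:
  fixes c :: "nat \<Rightarrow> real"
  shows "(\<lambda>z. \<Sum>i<k. (z i + c i)\<^sup>2) \<in> borel_measurable (std_normal_vec k)"
proof -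
  have [measurable]: "(\<lambda>z. z i) \<in> borel_measurable (std_normal_vec k)" if "i \<in> {..<k}" for i
    using that measurable_std_normal_vec_component by auto
  show ?thesis by measurable
qed

lemma cdf_noncentral_chi_squared:
  "cdf (noncentral_chi_squared k d) t
    = measure (std_normal_vec k) {z \<in> space (std_normal_vec k). (\<Sum>i<k. (z i + nc_shift d i)\<^sup>2) \<le> t}"
proof -
  have "cdf (noncentral_chi_squared k d) t
      = measure (std_normal_vec k) ((\<lambda>z. \<Sum>i<k. (z i + nc_shift d i)\<^sup>2) -` {..t} \<inter> space (std_normal_vec k))"
    unfolding cdf_def noncentral_chi_squared_def by (rule measure_distr) auto
  thus ?thesis by (simp add: vimage_def Int_def conj_commute)
qed

text \<open>The shift has squared norm \<open>d\<close>, so \<open>v\<close> is the centre, and the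
  two Chernoff tails become bounds on the distribution function away from it. In this form they can
  be inverted in \<open>d\<close>.\<close>

lemma noncentral_chi_squared_tails:
  fixes k :: nat and d L t :: real
  assumes k: "k > 0" and d: "d \<ge> 0" and L: "L > 0"
  defines "v \<equiv> real k + d"
  shows "t \<le> v - dev v L \<Longrightarrow> cdf (noncentral_chi_squared k d) t \<le> exp (- L)"
    and "t \<ge> v + dev v L \<Longrightarrow> cdf (noncentral_chi_squared k d) t \<ge> 1 - exp (- L)"
proof -
  let ?P = "std_normal_vec k"
  let ?S = "\<lambda>z. \<Sum>i<k. (z i + nc_shift d i)\<^sup>2"
  interpret P: prob_space ?P by (rule prob_space_std_normal_vec)
  have "(\<Sum>i<k. (nc_shift d i)\<^sup>2) = (\<Sum>i<k. if i = 0 then d else 0)"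
    using d by (intro sum.cong) auto
  also have "\<dots> = d" using k by simp
  finally have v: "v = real (card {..<k}) + (\<Sum>i\<in>{..<k}. (nc_shift d i)\<^sup>2)" by (simp add: v_def)
  have tail: "P.prob {z\<in>space ?P. sg * (?S z - v) \<ge> dev v L} \<le> exp (- L)" if "\<bar>sg\<bar> = 1" for sg
    unfolding v using that
    by (intro P.shifted_squares_tail[where a = "nc_shift d"] indep_vars_std_normal_vec k L
        distributed_std_normal_vec_component) auto
  show "cdf (noncentral_chi_squared k d) t \<le> exp (- L)" if t: "t \<le> v - dev v L"
  proof -
    have "cdf (noncentral_chi_squared k d) t \<le> P.prob {z\<in>space ?P. (- 1) * (?S z - v) \<ge> dev v L}"
      unfolding cdf_noncentral_chi_squared using t by (intro P.finite_measure_mono) auto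
    with tail[of "- 1"] show ?thesis by simp
  qed
  show "cdf (noncentral_chi_squared k d) t \<ge> 1 - exp (- L)" if t: "t \<ge> v + dev v L"
  proof -
    have "1 - P.prob {z\<in>space ?P. ?S z \<le> t} = P.prob (space ?P - {z\<in>space ?P. ?S z \<le> t})"
      by (subst P.prob_compl) auto
    also have "\<dots> \<le> P.prob {z\<in>space ?P. 1 * (?S z - v) \<ge> dev v L}"
      using t by (intro P.finite_measure_mono) auto
    also note tail[of 1]
    finally show ?thesis unfolding cdf_noncentral_chi_squared by simp
  qed
qed

text \<open>Continuity in the noncentrality makes the minimum and maximum defining the confidence bounds
  attained; the only points to exclude lie on the sphere, which is a null set.\<close>

lemma AE_nc_sum_neq:
  assumes k: "k > 0"
  shows "AE z in std_normal_vec k. (\<Sum>i<k. (z i + nc_shift d i)\<^sup>2) \<noteq> t"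
proof -
  let ?P = "std_normal_vec k"
  let ?S = "\<lambda>z. \<Sum>i<k. (z i + nc_shift d i)\<^sup>2"
  interpret product_sigma_finite "\<lambda>_ :: nat. std_normal"
    by (rule product_sigma_finite.intro, rule prob_space_imp_sigma_finite, rule prob_space_normal_density, simp)
  \<comment> \<open>Fubini in the first coordinate: given the others, at most two of its values lie
    on the sphere, and these form a null set.\<close>
  have split: "{..<k} = insert 0 {1..<k}" using k by auto
  let ?A = "{z\<in>space ?P. ?S z = t}"
  have A: "?A \<in> sets ?P" by measurable
  have "emeasure ?P ?A = (\<integral>\<^sup>+z. indicator ?A z \<partial>?P)" using A by simp
  also have "\<dots> = (\<integral>\<^sup>+x. (\<integral>\<^sup>+y. indicator ?A (x(0 := y)) \<partial>std_normal) \<partial>(\<Pi>\<^sub>M i\<in>{1..<k}. std_normal))"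
    using A unfolding split by (intro product_nn_integral_insert) auto
  also have "\<dots> = (\<integral>\<^sup>+x. 0 \<partial>(\<Pi>\<^sub>M i\<in>{1..<k}. std_normal))"
  proof (intro nn_integral_cong)
    fix x assume "x \<in> space (\<Pi>\<^sub>M i\<in>{1..<k}. std_normal)"
    define c where "c = (\<Sum>i\<in>{1..<k}. (x i)\<^sup>2)"
    have S: "?S (x(0 := y)) = (y + sqrt d)\<^sup>2 + c" for y
    proof -
      have "?S (x(0 := y)) = (y + sqrt d)\<^sup>2 + (\<Sum>i\<in>{1..<k}. ((x(0 := y)) i + nc_shift d i)\<^sup>2)"
        unfolding split by (subst sum.insert) auto
      also have "(\<Sum>i\<in>{1..<k}. ((x(0 := y)) i + nc_shift d i)\<^sup>2) = c"
        unfolding c_def by (intro sum.cong) auto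
      finally show ?thesis .
    qed
    have "{y. x(0 := y) \<in> ?A} \<subseteq> {sqrt (t - c) - sqrt d, - sqrt (t - c) - sqrt d}"
    proof
      fix y assume "y \<in> {y. x(0 := y) \<in> ?A}"
      hence "(y + sqrt d)\<^sup>2 = t - c" using S[of y] by simp
      hence "\<bar>y + sqrt d\<bar> = sqrt (t - c)" by (metis real_sqrt_abs)
      thus "y \<in> {sqrt (t - c) - sqrt d, - sqrt (t - c) - sqrt d}" by (auto simp: abs_if split: if_splits)
    qed
    hence "finite {y. x(0 := y) \<in> ?A}" by (rule finite_subset) simp
    hence "{y. x(0 := y) \<in> ?A} \<in> null_sets lborel" by (rule finite_imp_null_set_lborel)
    hence "AE y in lborel. \<not> x(0 := y) \<in> ?A" by (rule AE_I') auto
    hence "AE y in std_normal. \<not> x(0 := y) \<in> ?A" by (auto simp: AE_density)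
    hence "(\<integral>\<^sup>+y. indicator ?A (x(0 := y)) \<partial>std_normal) = (\<integral>\<^sup>+y. 0 \<partial>std_normal)"
      by (intro nn_integral_cong_AE) auto
    thus "(\<integral>\<^sup>+y. indicator ?A (x(0 := y)) \<partial>std_normal) = 0" by simp
  qed
  finally have "emeasure ?P ?A = 0" by simp
  thus ?thesis using A by (subst AE_iff_null) auto
qed

text \<open>Dominated convergence for events on one fixed Gaussian space: \<open>d\<close> enters
  only through the shift, which depends on it continuously.\<close>

lemma continuous_on_cdf_noncentral_chi_squared:
  assumes k: "k > 0"
  shows "continuous_on UNIV (\<lambda>d. cdf (noncentral_chi_squared k d) t)"
proof (unfold continuous_on_sequentially, intro allI ballI impI, elim conjE)
  fix x :: "nat \<Rightarrow> real" and d assume x: "x \<longlonglongrightarrow> d"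
  let ?P = "std_normal_vec k"
  let ?S = "\<lambda>d z. \<Sum>i<k. (z i + nc_shift d i)\<^sup>2"
  interpret P: prob_space ?P by (rule prob_space_std_normal_vec)
  have int: "cdf (noncentral_chi_squared k d) t = (\<integral>z. indicator {z\<in>space ?P. ?S d z \<le> t} z \<partial>?P)" for d
    unfolding cdf_noncentral_chi_squared by simp
  have "(\<lambda>n. \<integral>z. indicator {z\<in>space ?P. ?S (x n) z \<le> t} z \<partial>?P)
      \<longlonglongrightarrow> (\<integral>z. (indicator {z\<in>space ?P. ?S d z \<le> t} z :: real) \<partial>?P)"
  proof (rule integral_dominated_convergence[where w = "\<lambda>_. 1"])
    show "AE z in ?P. (\<lambda>n. indicator {z\<in>space ?P. ?S (x n) z \<le> t} z)
      \<longlonglongrightarrow> (indicator {z\<in>space ?P. ?S d z \<le> t} z :: real)"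
      using AE_nc_sum_neq[OF k, of d t] AE_space
    proof eventually_elim
      case (elim z)
      have lim: "(\<lambda>n. ?S (x n) z) \<longlonglongrightarrow> ?S d z"
        by (intro tendsto_sum tendsto_power tendsto_add tendsto_const)
          (simp add: tendsto_real_sqrt[OF x])
      \<comment> \<open>Off the sphere the limit lies strictly on one side of \<open>t\<close>, so
        the events at \<open>x n\<close> eventually agree with the limiting one.\<close>
      have "eventually (\<lambda>n. (?S (x n) z \<le> t) = (?S d z \<le> t)) sequentially"
      proof (cases "?S d z < t")
        case True
        from order_tendstoD(2)[OF lim this] show ?thesis
          by eventually_elim (use True in auto)
      next
        case False
        with elim have "t < ?S d z" by auto
        from order_tendstoD(1)[OF lim this] show ?thesis
          by eventually_elim (use \<open>t < ?S d z\<close> in auto)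
      qed
      hence "eventually (\<lambda>n. indicator {z\<in>space ?P. ?S (x n) z \<le> t} z
          = (indicator {z\<in>space ?P. ?S d z \<le> t} z :: real)) sequentially"
        by eventually_elim (simp add: indicator_def)
      thus ?case by (rule tendsto_eventually)
    qed
  qed (auto simp: indicator_def)
  thus "((\<lambda>d. cdf (noncentral_chi_squared k d) t) \<circ> x) \<longlonglongrightarrow> cdf (noncentral_chi_squared k d) t"
    by (simp add: int o_def)
qed

section \<open>Confidence bounds and the oracle inequality\<close>

lemma dev_nonneg: "v \<ge> 0 \<Longrightarrow> L \<ge> 0 \<Longrightarrow> dev v L \<ge> 0"
  by (simp add: dev_def)

lemma dev_mono: "0 \<le> v \<Longrightarrow> 0 \<le> L \<Longrightarrow> v \<le> v' \<Longrightarrow> L \<le> L' \<Longrightarrow> dev v L \<le> dev v' L'"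
  unfolding dev_def by (intro add_mono mult_left_mono real_sqrt_le_mono mult_mono) auto

text \<open>Expanding a square: a term of order \<open>sqrt (v * L)\<close> costs only half of
  \<open>v\<close>, which can be moved to the other side, plus a multiple of
  \<open>L\<close>.\<close>

lemma mult_sqrt_le:
  fixes a v L :: real
  assumes "v \<ge> 0" "L \<ge> 0"
  shows "a * sqrt (v * L) \<le> v / 2 + a\<^sup>2 * L / 2"
proof -
  have "0 \<le> (sqrt v - a * sqrt L)\<^sup>2" by simp
  also have "\<dots> = v + a\<^sup>2 * L - 2 * (a * sqrt (v * L))"
    using assms by (simp add: power2_diff power_mult_distrib real_sqrt_mult)
  finally show ?thesis by simp
qed

text \<open>The 12 is \<open>4\<^sup>2 / 2\<close> from the square root plus the linear 4.\<close>

lemma dev_le: "v \<ge> 0 \<Longrightarrow> L \<ge> 0 \<Longrightarrow> dev v L \<le> v / 2 + 12 * L"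
  using mult_sqrt_le[of v L 4] by (simp add: dev_def)

lemma le_if_diff_dev_le: "v \<ge> 0 \<Longrightarrow> L \<ge> 0 \<Longrightarrow> v - dev v L \<le> T \<Longrightarrow> v \<le> 2 * T + 24 * L"
  using dev_le[of v L] by linarith

lemma le_diff_dev: "v \<ge> 0 \<Longrightarrow> L \<ge> 0 \<Longrightarrow> 2 * T + 24 * L \<le> v \<Longrightarrow> T \<le> v - dev v L"
  using dev_le[of v L] by linarith

text \<open>The constant produced by \<open>sqrt_absorb\<close>: \<open>a\<close> times
  \<open>3 + c\<close> with the \<open>c\<close> of its proof.\<close>

definition absorb :: "real \<Rightarrow> real" where
  "absorb a = a * (3 + 2 * a + 2 * a\<^sup>2)"

lemma absorb_nonneg: "a \<ge> 0 \<Longrightarrow> absorb a \<ge> 0"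
  by (simp add: absorb_def)

text \<open>Removes the unknown \<open>w\<close> from the right-hand side in two rounds: a crude
  bound of \<open>w\<close> by multiples of \<open>v\<close> and \<open>L\<close>, then its
  insertion into \<open>sqrt (w * L)\<close>. Only the root is treated crudely, so \<open>v\<close>
  keeps the coefficient 1.\<close>

lemma sqrt_absorb:
  fixes a v w L :: real
  assumes nn: "v \<ge> 0" "w \<ge> 0" "L \<ge> 0" "a \<ge> 0"
    and le: "w \<le> v + a * (sqrt (w * L) + sqrt (v * L) + L)"
  shows "w \<le> v + absorb a * (sqrt (v * L) + L)"
proof -
  define c where "c = 2 * a + 2 * a\<^sup>2"
  have c: "c \<ge> 0" using nn by (simp add: c_def)
  have "w \<le> v + a * sqrt (w * L) + a * sqrt (v * L) + a * L"
    using le by (simp add: algebra_simps)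
  also have "\<dots> \<le> v + (w / 2 + a\<^sup>2 * L / 2) + (v / 2 + a\<^sup>2 * L / 2) + a * L"
    using mult_sqrt_le[of w L a] mult_sqrt_le[of v L a] nn by linarith
  finally have "w \<le> 3 * v + c * L" by (simp add: c_def algebra_simps)
  \<comment> \<open>Enlarging 3 to 4 makes the square root of the coefficient exact.\<close>
  also have "\<dots> \<le> 4 * v + c * L" using nn by simp
  finally have "w * L \<le> (4 * v + c * L) * L" using nn by (intro mult_right_mono) auto
  hence "sqrt (w * L) \<le> sqrt (4 * (v * L) + c * L\<^sup>2)"
    by (intro real_sqrt_le_mono) (simp add: algebra_simps power2_eq_square)
  also have "\<dots> \<le> sqrt (4 * (v * L)) + sqrt (c * L\<^sup>2)"
    using nn c by (intro sqrt_add_le_add_sqrt) auto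
  also have "\<dots> = 2 * sqrt (v * L) + sqrt c * L" using nn by (simp add: real_sqrt_mult)
  also have "sqrt c \<le> 1 + c"
    using c by (intro real_le_lsqrt) (auto simp: power2_eq_square algebra_simps)
  finally have "sqrt (w * L) \<le> 2 * sqrt (v * L) + (1 + c) * L"
    using nn by (simp add: mult_right_mono)
  hence "a * (sqrt (w * L) + sqrt (v * L) + L) \<le> a * (3 * sqrt (v * L) + (2 + c) * L)"
    using nn by (intro mult_left_mono) (auto simp: algebra_simps)
  also have "\<dots> \<le> a * ((3 + c) * sqrt (v * L) + (3 + c) * L)"
    using nn c by (intro mult_left_mono add_mono mult_right_mono) auto
  also have "\<dots> = absorb a * (sqrt (v * L) + L)"
    by (simp add: absorb_def c_def algebra_simps)
  finally show ?thesis using le by linarith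
qed

section \<open>Attained extrema and the location of the confidence bounds\<close>

lemma Least_real_mem:
  fixes S :: "real set"
  assumes "closed S" "S \<noteq> {}" "bdd_below S"
  shows "(LEAST d. d \<in> S) \<in> S"
proof -
  have "Inf S \<in> S" using assms by (intro closed_contains_Inf)
  moreover have "Inf S \<le> d" if "d \<in> S" for d using that assms by (intro cInf_lower)
  ultimately show ?thesis by (rule LeastI2_order)
qed

lemma Greatest_real_mem:
  fixes S :: "real set"
  assumes "closed S" "S \<noteq> {}" "bdd_above S"
  shows "(GREATEST d. d \<in> S) \<in> S"
proof -
  have "Sup S \<in> S" using assms by (intro closed_contains_Sup)
  moreover have "d \<le> Sup S" if "d \<in> S" for d using that assms by (intro cSup_upper)
  ultimately show ?thesis by (rule GreatestI2_order)
qed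

lemma T_stat_nonneg: "T_stat \<sigma> x J \<ge> 0"
  by (simp add: T_stat_def sum_nonneg)

context
  fixes \<alpha> \<sigma> L :: real and \<C> :: "nat set set" and x :: "nat \<Rightarrow> real" and J :: "nat set"
  assumes L: "L > 0" "exp (- L) < \<alpha> / (2 * real (num_diff \<C>))"
    and J: "finite J" "J \<noteq> {}"
begin

lemma card_J_pos: "card J > 0"
  using J by (simp add: card_gt_0_iff)

text \<open>At an admissible noncentrality the distribution function exceeds
  \<open>exp (- L)\<close>, so the observed statistic cannot lie in the lower tail. The alternative
  0 is the default when no noncentrality is admissible.\<close>

lemma delta2_upper_cases:
  defines "d \<equiv> delta2_upper \<alpha> \<sigma> \<C> x J"
  shows "d = 0 \<or> d \<ge> 0 \<and> real (card J) + d - dev (real (card J) + d) L \<le> T_stat \<sigma> x J"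
proof -
  let ?p = "\<alpha> / (2 * real (num_diff \<C>))"
  let ?F = "\<lambda>d. cdf (noncentral_chi_squared (card J) d) (T_stat \<sigma> x J)"
  define S where "S = {d. 0 \<le> d \<and> ?p \<le> ?F d}"
  have lower: "real (card J) + d - dev (real (card J) + d) L \<le> T_stat \<sigma> x J" if "d \<in> S" for d
  proof (rule ccontr)
    assume "\<not> ?thesis"
    hence "?F d \<le> exp (- L)"
      using that L card_J_pos by (intro noncentral_chi_squared_tails) (auto simp: S_def)
    with L that show False by (simp add: S_def)
  qed
  show ?thesis
  proof (cases "S = {}")
    case True
    hence "d = 0" by (auto simp: d_def delta2_upper_def S_def)
    thus ?thesis ..
  next
    case False
    have "d = (GREATEST d. d \<in> S)"
      using False J by (auto simp: d_def delta2_upper_def S_def)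
    \<comment> \<open>\<open>GREATEST\<close> on the reals is informative once the supremum is
      attained: closedness comes from continuity, boundedness from solving \<open>lower\<close> for
      \<open>d\<close>.\<close>
    moreover have "(GREATEST d. d \<in> S) \<in> S"
    proof (rule Greatest_real_mem)
      have "S = {0..} \<inter> ?F -` {?p..}" by (auto simp: S_def)
      also have "closed \<dots>"
        using continuous_on_cdf_noncentral_chi_squared[OF card_J_pos]
        by (intro closed_Int closed_vimage) auto
      finally show "closed S" .
      have "d \<le> 2 * T_stat \<sigma> x J + 24 * L" if "d \<in> S" for d
      proof -
        have "d \<ge> 0" using that by (simp add: S_def)
        hence "real (card J) + d \<le> 2 * T_stat \<sigma> x J + 24 * L"
          using lower[OF that] L by (intro le_if_diff_dev_le) auto
        thus ?thesis by simp
      qed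
      thus "bdd_above S" by (rule bdd_aboveI)
    qed (use False in auto)
    ultimately have "d \<in> S" by simp
    with lower show ?thesis by (auto simp: S_def)
  qed
qed

text \<open>At an admissible noncentrality the distribution function is below
  \<open>1 - exp (- L)\<close>, so the statistic cannot lie in the upper tail. The assumption
  \<open>p\<close> keeps the threshold positive, so that large noncentralities are
  admissible.\<close>

lemma delta2_lower_bound:
  assumes p: "\<alpha> / (2 * real (num_diff \<C>)) < 1"
  defines "d \<equiv> delta2_lower \<alpha> \<sigma> \<C> x J"
  shows "d \<ge> 0" and "T_stat \<sigma> x J \<le> real (card J) + d + dev (real (card J) + d) L"
proof -
  let ?p = "\<alpha> / (2 * real (num_diff \<C>))"
  let ?F = "\<lambda>d. cdf (noncentral_chi_squared (card J) d) (T_stat \<sigma> x J)"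
  define S where "S = {d. 0 \<le> d \<and> ?F d \<le> 1 - ?p}"
  have "d = (LEAST d. d \<in> S)"
    using J by (auto simp: d_def delta2_lower_def S_def)
  moreover have "(LEAST d. d \<in> S) \<in> S"
  proof (rule Least_real_mem)
    have "S = {0..} \<inter> ?F -` {..1 - ?p}" by (auto simp: S_def)
    also have "closed \<dots>"
      using continuous_on_cdf_noncentral_chi_squared[OF card_J_pos]
      by (intro closed_Int closed_vimage) auto
    finally show "closed S" .
    show "bdd_below S" by (rule bdd_belowI[of _ 0]) (simp add: S_def)
    \<comment> \<open>\<open>L'\<close> is chosen so that \<open>exp (- L') \<le> 1 - ?p\<close>,
      and \<open>e\<close> so large that the statistic lies in the lower tail at level
      \<open>L'\<close>; thus \<open>e\<close> witnesses that \<open>S\<close> is nonempty.\<close>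
    define L' where "L' = 1 - ln (1 - ?p)"
    define e where "e = 2 * T_stat \<sigma> x J + 24 * L'"
    have "?p > 0" using L(2) exp_gt_zero[of "- L"] by linarith
    hence "ln (1 - ?p) < 0" using p by (intro ln_less_zero) auto
    hence L': "L' > 0" by (simp add: L'_def)
    have e: "e \<ge> 0" using L' T_stat_nonneg[of \<sigma> x J] by (simp add: e_def)
    have "?F e \<le> exp (- L')"
      using e L' card_J_pos by (intro noncentral_chi_squared_tails le_diff_dev) (auto simp: e_def)
    also have "\<dots> = exp (- 1) * (1 - ?p)" using p by (simp add: L'_def exp_diff exp_minus field_simps)
    also have "\<dots> \<le> 1 * (1 - ?p)" using p by (intro mult_right_mono) auto
    finally have "e \<in> S" using e by (simp add: S_def)
    thus "S \<noteq> {}" by auto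
  qed
  ultimately have d: "d \<in> S" by simp
  thus "d \<ge> 0" by (simp add: S_def)
  show "T_stat \<sigma> x J \<le> real (card J) + d + dev (real (card J) + d) L"
  proof (rule ccontr)
    assume "\<not> ?thesis"
    hence "1 - exp (- L) \<le> ?F d"
      using d L card_J_pos by (intro noncentral_chi_squared_tails) (auto simp: S_def)
    with L d show False by (simp add: S_def)
  qed
qed

text \<open>The statistic is not far above the centre for \<open>\<delta>\<close> and not far below
  the centre for the confidence bound. Chaining the two leaves a deviation containing the bound
  itself, which \<open>sqrt_absorb\<close> removes; the two \<open>dev\<close> terms give the
  8.\<close>

lemma delta2_upper_le:
  fixes \<delta> :: real
  assumes \<delta>: "\<delta> \<ge> 0" and T: "T_stat \<sigma> x J \<le> real (card J) + \<delta> + dev (real (card J) + \<delta>) L"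
  shows "delta2_upper \<alpha> \<sigma> \<C> x J \<le> \<delta> + absorb 8 * (sqrt ((real (card J) + \<delta>) * L) + L)"
proof -
  define d where "d = delta2_upper \<alpha> \<sigma> \<C> x J"
  have "d = 0 \<or> d \<ge> 0 \<and> real (card J) + d - dev (real (card J) + d) L \<le> T_stat \<sigma> x J"
    unfolding d_def by (rule delta2_upper_cases)
  thus ?thesis
  proof
    assume "d = 0"
    thus ?thesis using \<delta> L absorb_nonneg[of 8] by (simp add: d_def[symmetric])
  next
    assume d: "d \<ge> 0 \<and> real (card J) + d - dev (real (card J) + d) L \<le> T_stat \<sigma> x J"
    have "real (card J) + d \<le> real (card J) + \<delta> + dev (real (card J) + d) L + dev (real (card J) + \<delta>) L"
      using d T by linarith
    also have "\<dots> \<le> real (card J) + \<delta> + 8 * (sqrt ((real (card J) + d) * L) + sqrt ((real (card J) + \<delta>) * L) + L)"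
      using d \<delta> L by (simp add: dev_def)
    finally have "real (card J) + d \<le> real (card J) + \<delta> + absorb 8 * (sqrt ((real (card J) + \<delta>) * L) + L)"
      using d \<delta> L by (intro sqrt_absorb) auto
    thus ?thesis by (simp add: d_def)
  qed
qed

text \<open>If the confidence bound is at most \<open>\<delta>\<close>, monotonicity dominates its
  deviation by that at \<open>\<delta>\<close>; otherwise the claim is immediate. The 8 is enlarged
  to match the upper bound.\<close>

lemma delta2_lower_ge:
  fixes \<delta> :: real
  assumes p: "\<alpha> / (2 * real (num_diff \<C>)) < 1"
    and \<delta>: "\<delta> \<ge> 0" and T: "T_stat \<sigma> x J \<ge> real (card J) + \<delta> - dev (real (card J) + \<delta>) L"
  shows "\<delta> \<le> delta2_lower \<alpha> \<sigma> \<C> x J + absorb 8 * (sqrt ((real (card J) + \<delta>) * L) + L)"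
proof -
  define d where "d = delta2_lower \<alpha> \<sigma> \<C> x J"
  note d = delta2_lower_bound[OF p, folded d_def]
  have nn: "sqrt ((real (card J) + \<delta>) * L) \<ge> 0" using \<delta> L by simp
  have "\<delta> \<le> d + 8 * (sqrt ((real (card J) + \<delta>) * L) + L)"
  proof (cases "d \<le> \<delta>")
    case True
    have "dev (real (card J) + d) L \<le> dev (real (card J) + \<delta>) L"
      using True d L by (intro dev_mono) auto
    hence "\<delta> \<le> d + 2 * dev (real (card J) + \<delta>) L" using d T by linarith
    thus ?thesis by (simp add: dev_def)
  next
    case False
    have "0 \<le> 8 * (sqrt ((real (card J) + \<delta>) * L) + L)" using nn L by simp
    thus ?thesis using False by (intro add_increasing2) auto
  qed
  also have "8 * (sqrt ((real (card J) + \<delta>) * L) + L) \<le> absorb 8 * (sqrt ((real (card J) + \<delta>) * L) + L)"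
    using nn L by (intro mult_right_mono) (auto simp: absorb_def)
  finally show ?thesis by (simp add: d_def)
qed

end

section \<open>The deterministic oracle inequality\<close>

lemma oracle_absorb:
  fixes g h s v1 v2 a :: real
  assumes nn: "g \<ge> 0" "h \<ge> 0" "s \<ge> 0" "a \<ge> 0"
    and v: "v1 \<le> 2 * (g + h) + 24 * s" "v2 \<le> 2 * (g + h) + 24 * s"
    and le: "g \<le> h + a * (sqrt (v1 * s) + sqrt (v2 * s) + s)"
  shows "g \<le> h + absorb (11 * a) * (sqrt (h * s) + s)"
proof -
  have *: "sqrt (v * s) \<le> 2 * sqrt (g * s) + 2 * sqrt (h * s) + 5 * s"
    if "v \<le> 2 * (g + h) + 24 * s" for v
  proof -
    have "v * s \<le> (2 * (g + h) + 24 * s) * s" using that nn by (intro mult_right_mono)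
    \<comment> \<open>The coefficients are rounded up to 4 and 25 so that their roots are exact; two
      such bounds and one further \<open>s\<close> give the 11 below.\<close>
    also have "\<dots> \<le> 4 * (g * s) + (4 * (h * s) + 25 * s\<^sup>2)"
      using nn by (simp add: algebra_simps power2_eq_square)
    finally have "sqrt (v * s) \<le> sqrt (4 * (g * s) + (4 * (h * s) + 25 * s\<^sup>2))" by simp
    also have "\<dots> \<le> sqrt (4 * (g * s)) + sqrt (4 * (h * s) + 25 * s\<^sup>2)"
      using nn by (intro sqrt_add_le_add_sqrt) auto
    also have "sqrt (4 * (h * s) + 25 * s\<^sup>2) \<le> sqrt (4 * (h * s)) + sqrt (25 * s\<^sup>2)"
      using nn by (intro sqrt_add_le_add_sqrt) auto
    finally show ?thesis using nn by (simp add: real_sqrt_mult)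
  qed
  have "sqrt (v1 * s) + sqrt (v2 * s) + s \<le> 4 * sqrt (g * s) + 4 * sqrt (h * s) + 11 * s"
    using *[OF v(1)] *[OF v(2)] by simp
  also have "\<dots> \<le> 11 * (sqrt (g * s) + sqrt (h * s) + s)" using nn by simp
  finally have "a * (sqrt (v1 * s) + sqrt (v2 * s) + s) \<le> a * (11 * (sqrt (g * s) + sqrt (h * s) + s))"
    using nn by (intro mult_left_mono)
  hence "g \<le> h + (11 * a) * (sqrt (g * s) + sqrt (h * s) + s)" using le by (simp add: mult_ac)
  thus ?thesis using nn by (intro sqrt_absorb) auto
qed

lemma half_bound:
  fixes k L S :: real
  assumes "k \<ge> 0" "L \<ge> 0" "\<bar>S - k\<bar> \<le> dev k L"
  shows "k \<le> 2 * S + 24 * L"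
  using dev_le[OF assms(1,2)] assms(3) by linarith

context
  fixes n :: nat and t w :: "nat \<Rightarrow> real"
begin

text \<open>With weights \<open>w = 1\<close> this is the risk and with squared noise as \<open>w\<close> it is the loss, in units of
  \<open>\<sigma>\<^sup>2\<close>, so that one argument serves both.\<close>

definition wloss :: "nat set \<Rightarrow> real" where
  "wloss C = (\<Sum>i\<in>{1..n} - C. (t i)\<^sup>2) + (\<Sum>i\<in>C. w i)"

text \<open>Coordinates in both sets or in neither contribute equally to both sides and
  cancel.\<close>

lemma wloss_diff:
  assumes "C \<subseteq> {1..n}" "D \<subseteq> {1..n}"
  shows "wloss C - wloss D = (\<Sum>i\<in>D - C. (t i)\<^sup>2) - (\<Sum>i\<in>C - D. (t i)\<^sup>2)
    + (\<Sum>i\<in>C - D. w i) - (\<Sum>i\<in>D - C. w i)"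
proof -
  have fin: "finite C" "finite D" using assms by (auto intro: finite_subset)
  have 1: "(\<Sum>i\<in>A. f i) = (\<Sum>i\<in>A - B. f i) + (\<Sum>i\<in>A \<inter> B. f i)" if "finite A" for A B :: "nat set" and f :: "nat \<Rightarrow> real"
    using sum.Int_Diff[OF that, of f B] by simp
  have eqs: "{1..n} - C - ({1..n} - D) = D - C" "{1..n} - D - ({1..n} - C) = C - D" using assms by auto
  have c: "({1..n} - C) \<inter> ({1..n} - D) = ({1..n} - D) \<inter> ({1..n} - C)" "C \<inter> D = D \<inter> C" by auto
  show ?thesis
    unfolding wloss_def
    using 1[of "{1..n} - C" "\<lambda>i. (t i)\<^sup>2" "{1..n} - D"] 1[of "{1..n} - D" "\<lambda>i. (t i)\<^sup>2" "{1..n} - C"]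
      1[OF fin(1), of w D] 1[OF fin(2), of w C]
    unfolding eqs c by simp
qed

lemma wloss_nonneg:
  "(\<And>i. w i \<ge> 0) \<Longrightarrow> wloss C \<ge> 0"
  unfolding wloss_def by (intro add_nonneg_nonneg sum_nonneg) auto

text \<open>A coordinate in \<open>C - D\<close> contributes its noise to the loss of
  \<open>C\<close> and its bias to the loss of \<open>D\<close>.\<close>

lemma wloss_sum_le:
  assumes "C \<subseteq> {1..n}" "D \<subseteq> {1..n}" "\<And>i. w i \<ge> 0"
  shows "(\<Sum>i\<in>C - D. w i) + (\<Sum>i\<in>C - D. (t i)\<^sup>2) \<le> wloss C + wloss D"
proof -
  have "(\<Sum>i\<in>C - D. w i) \<le> (\<Sum>i\<in>C. w i)"
    using assms by (intro sum_mono2) (auto intro: finite_subset)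
  moreover have "(\<Sum>i\<in>C - D. (t i)\<^sup>2) \<le> (\<Sum>i\<in>{1..n} - D. (t i)\<^sup>2)"
    using assms by (intro sum_mono2) auto
  moreover have "(\<Sum>i\<in>{1..n} - C. (t i)\<^sup>2) \<ge> 0" "(\<Sum>i\<in>D. w i) \<ge> 0"
    using assms by (auto intro: sum_nonneg)
  ultimately show ?thesis by (simp add: wloss_def)
qed

text \<open>Membership of \<open>C\<close>, tested against \<open>D\<close>, compares the confidence
  bounds on the two differences. Replacing them by the true noncentralities, and cardinalities by
  weights, turns this into a comparison of \<open>wloss\<close> up to deviations that
  \<open>oracle_absorb\<close> removes.\<close>

lemma wloss_oracle:
  fixes \<alpha> \<sigma> L :: real
  assumes \<C>: "\<C> \<subseteq> Pow {1..n}" and w: "\<And>i. w i \<ge> 0"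
    and L: "L > 0" "exp (- L) < \<alpha> / (2 * real (num_diff \<C>))"
    and p: "\<alpha> / (2 * real (num_diff \<C>)) < 1"
    and C: "C \<in> conf_region \<alpha> \<sigma> \<C> x" and D: "D \<in> \<C>"
    and T: "\<And>J. J \<in> diff_sets \<C> \<Longrightarrow>
      \<bar>T_stat \<sigma> x J - (real (card J) + (\<Sum>i\<in>J. (t i)\<^sup>2))\<bar> \<le> dev (real (card J) + (\<Sum>i\<in>J. (t i)\<^sup>2)) L"
    and W: "\<And>J. J \<in> diff_sets \<C> \<Longrightarrow> \<bar>(\<Sum>i\<in>J. w i) - real (card J)\<bar> \<le> dev (real (card J)) L"
  shows "wloss C \<le> wloss D + absorb (11 * (2 * absorb 8 + 8)) * (sqrt (wloss D * L) + L)"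
proof -
  have C\<C>: "C \<in> \<C>" using C by (simp add: conf_region_def)
  hence sub: "C \<subseteq> {1..n}" "D \<subseteq> {1..n}" using \<C> D by auto
  hence fin: "finite C" "finite D" by (auto intro: finite_subset)
  have J: "C - D \<in> diff_sets \<C>" "D - C \<in> diff_sets \<C>" using C\<C> D by (auto simp: diff_sets_def)
  define \<delta> where "\<delta> J = (\<Sum>i\<in>J. (t i)\<^sup>2)" for J
  define v where "v J = real (card J) + \<delta> J" for J
  have \<delta>: "\<delta> J \<ge> 0" for J by (simp add: \<delta>_def sum_nonneg)
  have v: "v J \<ge> 0" for J using \<delta> by (simp add: v_def)
  define r where "r J = sqrt (v J * L)" for J
  have r: "r J \<ge> 0" for J using v L by (simp add: r_def)
  define a where "a = absorb 8"
  have a: "a \<ge> 0" by (simp add: a_def absorb_def)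
  have upper: "delta2_upper \<alpha> \<sigma> \<C> x (C - D) \<le> \<delta> (C - D) + a * (r (C - D) + L)"
  proof (cases "C - D = {}")
    \<comment> \<open>On the empty difference the bound is 0 by convention, and so is the
      noncentrality.\<close>
    case True
    show ?thesis unfolding True using a r L by (simp add: delta2_upper_def \<delta>_def)
  next
    case False
    thus ?thesis using T[OF J(1), folded \<delta>_def] fin \<delta> unfolding a_def r_def v_def
      by (intro delta2_upper_le L) auto
  qed
  have lower: "\<delta> (D - C) \<le> delta2_lower \<alpha> \<sigma> \<C> x (D - C) + a * (r (D - C) + L)"
  proof (cases "D - C = {}")
    case True
    show ?thesis unfolding True using a r L by (simp add: delta2_lower_def \<delta>_def)
  next
    case False
    thus ?thesis using T[OF J(2), folded \<delta>_def] fin \<delta> unfolding a_def r_def v_def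
      by (intro delta2_lower_ge L p) auto
  qed
  have card: "real (card C) - real (card D) = real (card (C - D)) - real (card (D - C))"
    using sum.Int_Diff[OF fin(1), of "\<lambda>_. 1 :: real" D] sum.Int_Diff[OF fin(2), of "\<lambda>_. 1 :: real" C]
    by (simp add: Int_commute)
  have conf: "delta2_upper \<alpha> \<sigma> \<C> x (C - D) - delta2_lower \<alpha> \<sigma> \<C> x (D - C) + real (card D) - real (card C) \<ge> 0"
    using C D by (simp add: conf_region_def)
  have devr: "dev (real (card J)) L \<le> 4 * r J + 4 * L" for J
    using dev_mono[of "real (card J)" L "v J" L] \<delta>[of J] L by (simp add: v_def r_def dev_def)
  have "wloss C - wloss D = \<delta> (D - C) - \<delta> (C - D) + (\<Sum>i\<in>C - D. w i) - (\<Sum>i\<in>D - C. w i)"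
    using wloss_diff[OF sub] by (simp add: \<delta>_def)
  \<comment> \<open>Each replacement of a weight sum by a cardinality costs one \<open>devr\<close>;
    this is where the separate \<open>4 * r\<close> terms and the \<open>8 * L\<close> come
    from.\<close>
  also have "\<dots> \<le> a * (r (C - D) + L) + a * (r (D - C) + L) + 4 * r (C - D) + 4 * r (D - C) + 8 * L"
    using upper lower conf card W[OF J(1)] W[OF J(2)] devr[of "C - D"] devr[of "D - C"] by linarith
  also have "\<dots> = (a + 4) * r (C - D) + (a + 4) * r (D - C) + (2 * a + 8) * L" by (simp add: algebra_simps)
  also have "\<dots> \<le> (2 * a + 8) * r (C - D) + (2 * a + 8) * r (D - C) + (2 * a + 8) * L"
    using a r L by (intro add_mono mult_right_mono) auto
  finally have le: "wloss C \<le> wloss D + (2 * a + 8) * (sqrt (v (C - D) * L) + sqrt (v (D - C) * L) + L)"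
    by (simp add: r_def algebra_simps)
  \<comment> \<open>\<open>v\<close> contains cardinalities but \<open>wloss\<close> contains
    weights; half of the cardinality absorbs the deviation between them.\<close>
  have k: "real (card J) \<le> 2 * (\<Sum>i\<in>J. w i) + 24 * L" if "J \<in> diff_sets \<C>" for J
    using W[OF that] L by (intro half_bound) auto
  have *: "k + d \<le> 2 * (g + h) + 24 * L" if "k \<le> 2 * S + 24 * L" "S + d \<le> g + h" "0 \<le> d" for k d g h S
    using that by argo
  have v1: "v (C - D) \<le> 2 * (wloss C + wloss D) + 24 * L"
    unfolding v_def \<delta>_def using \<delta>[of "C - D"]
    by (intro *[OF k[OF J(1)] wloss_sum_le[OF sub w]]) (simp add: \<delta>_def)
  have v2: "v (D - C) \<le> 2 * (wloss C + wloss D) + 24 * L"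
    unfolding v_def \<delta>_def add.commute[of "wloss C"] using \<delta>[of "D - C"]
    by (intro *[OF k[OF J(2)] wloss_sum_le[OF sub(2,1) w]]) (simp add: \<delta>_def)
  show ?thesis
    using le v1 v2 w L a unfolding a_def by (intro oracle_absorb wloss_nonneg) auto
qed

end

section \<open>The Gaussian sequence model\<close>

lemma loss_eq:
  assumes "C \<subseteq> {1..n}"
  shows "loss n \<theta> x C = (\<Sum>i\<in>{1..n} - C. (\<theta> i)\<^sup>2) + (\<Sum>i\<in>C. (x i - \<theta> i)\<^sup>2)"
proof -
  have "loss n \<theta> x C = (\<Sum>i\<in>{1..n}. (cand_est C x i - \<theta> i)\<^sup>2)"
    by (simp add: loss_def L2_set_def sum_nonneg)
  also have "\<dots> = (\<Sum>i\<in>{1..n} - C. (cand_est C x i - \<theta> i)\<^sup>2) + (\<Sum>i\<in>C. (cand_est C x i - \<theta> i)\<^sup>2)"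
    using assms by (intro sum.subset_diff) auto
  finally show ?thesis by (simp add: cand_est_def)
qed

section \<open>The number of set differences and the Bonferroni level\<close>

lemma diff_sets_facts:
  assumes "finite \<C>" "\<C> \<subseteq> Pow {1..n}"
  shows finite_diff_sets: "finite (diff_sets \<C>)"
    and card_diff_sets_le: "card (diff_sets \<C>) \<le> (card \<C>)\<^sup>2"
    and diff_sets_subset: "\<And>J. J \<in> diff_sets \<C> \<Longrightarrow> J \<subseteq> {1..n}"
proof -
  have *: "diff_sets \<C> = (\<lambda>(C, D). D - C) ` (\<C> \<times> \<C>)" by (auto simp: diff_sets_def)
  show "finite (diff_sets \<C>)" unfolding * using assms by simp
  show "card (diff_sets \<C>) \<le> (card \<C>)\<^sup>2" unfolding *
    using card_image_le[of "\<C> \<times> \<C>" "\<lambda>(C, D). D - C"] assms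
    by (simp add: card_cartesian_product power2_eq_square)
  show "J \<subseteq> {1..n}" if "J \<in> diff_sets \<C>" for J using that assms by (auto simp: diff_sets_def)
qed

text \<open>Two distinct sets have a nonvoid difference in one of the two orders, and the empty set
  is a further difference. This keeps the denominator of the Bonferroni level positive.\<close>

lemma num_diff_pos:
  assumes "finite \<C>" "card \<C> \<ge> 2" "\<C> \<subseteq> Pow {1..n}"
  shows "num_diff \<C> \<ge> 1"
proof -
  from assms(2) obtain C D where CD: "C \<in> \<C>" "D \<in> \<C>" "C \<noteq> D"
    by (metis card_le_Suc0_iff_eq assms(1) not_less_eq_eq numeral_2_eq_2)
  then obtain J where J: "J \<in> diff_sets \<C>" "J \<noteq> {}" by (auto simp: diff_sets_def)
  have "{} \<in> diff_sets \<C>" using CD by (auto simp: diff_sets_def)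
  with J have "card {{}, J} \<le> card (diff_sets \<C>)"
    using finite_diff_sets[OF assms(1,3)] by (intro card_mono) auto
  with J show ?thesis by (simp add: num_diff_def)
qed

text \<open>Since there are at most \<open>(card \<C>)\<^sup>2\<close> set differences, \<open>level_factor \<alpha> * ln (card \<C>)\<close> dominates
  the logarithm of the reciprocal of the Bonferroni level whenever \<open>card \<C> \<ge> 2\<close>.\<close>

definition level_factor :: "real \<Rightarrow> real" where
  "level_factor \<alpha> = 2 + ln (2 / \<alpha>) / ln 2"

lemma level_factor_ge: "0 < \<alpha> \<Longrightarrow> \<alpha> < 1 \<Longrightarrow> level_factor \<alpha> \<ge> 2"
  by (simp add: level_factor_def)

lemma exp_level_factor_less:
  assumes \<alpha>: "0 < \<alpha>" "\<alpha> < 1" and fin: "finite \<C>" and card: "card \<C> \<ge> 2" and sub: "\<C> \<subseteq> Pow {1..n}"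
    and L: "L \<ge> level_factor \<alpha> * ln (card \<C>)"
  shows "exp (- L) < \<alpha> / (2 * real (num_diff \<C>))"
proof -
  define l where "l = ln (real (card \<C>))"
  have l: "l \<ge> ln 2" using card by (simp add: l_def)
  \<comment> \<open>Strict because the empty difference is not counted.\<close>
  have "num_diff \<C> < (card \<C>)\<^sup>2"
    using card_diff_sets_le[OF fin sub] num_diff_pos[OF fin card sub] by (simp add: num_diff_def)
  hence "real (num_diff \<C>) < (real (card \<C>))\<^sup>2" by (metis of_nat_less_iff of_nat_power)
  also have "\<dots> = exp (2 * l)" using card by (simp add: l_def exp_double)
  finally have M: "real (num_diff \<C>) < exp (2 * l)" .
  \<comment> \<open>Since \<open>l\<close> is at least \<open>ln 2\<close>, the constant
    \<open>ln (2 / \<alpha>)\<close> is paid for by a multiple of \<open>l\<close>.\<close>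
  have "ln (2 / \<alpha>) = ln (2 / \<alpha>) / ln 2 * ln 2" by simp
  also have "\<dots> \<le> ln (2 / \<alpha>) / ln 2 * l" using l \<alpha> by (intro mult_left_mono) auto
  also have "\<dots> \<le> L - 2 * l" using L by (simp add: level_factor_def l_def algebra_simps)
  finally have "- L \<le> - (2 * l) - ln (2 / \<alpha>)" by simp
  hence "exp (- L) \<le> exp (- (2 * l) - ln (2 / \<alpha>))" by simp
  also have "\<dots> = \<alpha> / (2 * exp (2 * l))"
    using \<alpha> by (simp add: exp_diff exp_minus field_simps)
  also have "\<dots> < \<alpha> / (2 * real (num_diff \<C>))"
    using M \<alpha> num_diff_pos[OF fin card sub] by (intro divide_strict_left_mono) auto
  finally show ?thesis .
qed

text \<open>Turns a multiple of a deviation into a deviation at a higher level. The level grows by a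
  square because it enters \<open>dev\<close> under a root.\<close>

lemma dev_scale:
  assumes "v \<ge> 0" "l \<ge> 0" "z \<le> K" "1 \<le> K"
  shows "z * dev v l \<le> dev v (K\<^sup>2 * l)"
proof -
  have "K * 1 \<le> K * K" using assms by (intro mult_left_mono) auto
  hence K: "K \<le> K\<^sup>2" by (simp add: power2_eq_square)
  have "z * dev v l \<le> K * dev v l" using assms dev_nonneg by (intro mult_right_mono) auto
  also have "\<dots> = 4 * sqrt (v * (K\<^sup>2 * l)) + 4 * (K * l)"
    using assms by (simp add: dev_def real_sqrt_mult algebra_simps)
  also have "\<dots> \<le> dev v (K\<^sup>2 * l)"
    unfolding dev_def using K assms by (intro add_left_mono mult_left_mono mult_right_mono) auto
  finally show ?thesis .
qed

definition oracle_const :: real where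
  "oracle_const = absorb (11 * (2 * absorb 8 + 8))"

lemma oracle_const_nonneg: "oracle_const \<ge> 0"
  by (simp add: oracle_const_def absorb_def)

section \<open>Uniform control of all deviations at one sample size\<close>

locale gaussian_sequence = prob_space M for M :: "'a measure" +
  fixes n :: nat and \<theta> :: "nat \<Rightarrow> real" and \<sigma> :: real and \<epsilon> X :: "nat \<Rightarrow> 'a \<Rightarrow> real" and \<C> :: "nat set set"
  assumes \<sigma>: "\<sigma> > 0"
    and indep: "indep_vars (\<lambda>_. borel) \<epsilon> {1..n}"
    and \<epsilon>: "\<And>i. i \<in> {1..n} \<Longrightarrow> distributed M lborel (\<epsilon> i) (normal_density 0 \<sigma>)"
    and X: "\<And>i \<omega>. i \<in> {1..n} \<Longrightarrow> \<omega> \<in> space M \<Longrightarrow> X i \<omega> = \<theta> i + \<epsilon> i \<omega>"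
    and nonempty: "\<C> \<noteq> {}"
    and sub: "\<C> \<subseteq> Pow {1..n}"
begin

lemma fin: "finite \<C>"
  using sub by (rule finite_subset) simp

definition t :: "nat \<Rightarrow> real" where "t i = \<theta> i / \<sigma>"
definition z :: "nat \<Rightarrow> 'a \<Rightarrow> real" where "z i \<omega> = \<epsilon> i \<omega> / \<sigma>"
definition l :: real where "l = ln (real (card \<C>))"
definition v :: "nat set \<Rightarrow> real" where "v J = real (card J) + (\<Sum>i\<in>J. (t i)\<^sup>2)"

definition dev_T :: "nat set \<Rightarrow> 'a \<Rightarrow> real" where
  "dev_T J \<omega> = \<bar>(\<Sum>i\<in>J. (z i \<omega> + t i)\<^sup>2) - v J\<bar>"

definition dev_z :: "nat set \<Rightarrow> 'a \<Rightarrow> real" where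
  "dev_z J \<omega> = \<bar>(\<Sum>i\<in>J. (z i \<omega>)\<^sup>2) - real (card J)\<bar>"

text \<open>Normalising the deviations lets a single random variable, bounded in probability uniformly in the
  family, control all of them at once. For a family with one member the denominators vanish, and so do
  the quotients.\<close>

definition max_dev :: "'a \<Rightarrow> real" where
  "max_dev \<omega> = Max ((\<lambda>J. max (dev_T J \<omega> / dev (v J) l) (dev_z J \<omega> / dev (card J) l)) ` diff_sets \<C>)"

lemmas diffs = finite_diff_sets[OF fin sub] card_diff_sets_le[OF fin sub] diff_sets_subset[OF fin sub]

lemma diff_sets_nonempty: "diff_sets \<C> \<noteq> {}"
  using nonempty by (auto simp: diff_sets_def)

lemma z_distributed: "i \<in> {1..n} \<Longrightarrow> distributed M lborel (z i) std_normal_density"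
  using \<epsilon>[of i] normal_standard_normal_convert[OF \<sigma>, of "\<epsilon> i" 0] by (simp add: z_def[abs_def])

lemma z_indep: "J \<subseteq> {1..n} \<Longrightarrow> indep_vars (\<lambda>_. borel) z J"
  using indep_vars_subset[OF indep_vars_compose2[OF indep, of "\<lambda>_ x. x / \<sigma>" "\<lambda>_. borel"], of J]
  by (simp add: z_def[abs_def])

lemma z_measurable: "i \<in> {1..n} \<Longrightarrow> z i \<in> borel_measurable M"
  using distributed_measurable[OF z_distributed] by simp

lemma dev_T_measurable: "J \<in> diff_sets \<C> \<Longrightarrow> dev_T J \<in> borel_measurable M"
  using diffs(3)[of J] unfolding dev_T_def
  by (intro borel_measurable_abs borel_measurable_diff borel_measurable_sum borel_measurable_power
      borel_measurable_add z_measurable borel_measurable_const) auto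

lemma dev_z_measurable: "J \<in> diff_sets \<C> \<Longrightarrow> dev_z J \<in> borel_measurable M"
  using diffs(3)[of J] unfolding dev_z_def
  by (intro borel_measurable_abs borel_measurable_diff borel_measurable_sum borel_measurable_power
      borel_measurable_add z_measurable borel_measurable_const) auto

lemma max_dev_measurable [measurable]: "max_dev \<in> borel_measurable M"
  unfolding max_dev_def using diffs(1)
  by (intro borel_measurable_Max borel_measurable_max borel_measurable_divide dev_T_measurable
      dev_z_measurable borel_measurable_const)

lemma v_nonneg: "v J \<ge> 0"
  by (simp add: v_def sum_nonneg)

lemma l_nonneg: "l \<ge> 0"
  using nonempty fin by (simp add: l_def card_gt_0_iff Suc_le_eq)

lemma dev_pos: "card \<C> \<ge> 2 \<Longrightarrow> u \<ge> 0 \<Longrightarrow> dev u l > 0"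
  by (simp add: dev_def l_def add_nonneg_pos)

lemma max_dev_ge:
  assumes "J \<in> diff_sets \<C>"
  shows "dev_T J \<omega> / dev (v J) l \<le> max_dev \<omega>" "dev_z J \<omega> / dev (card J) l \<le> max_dev \<omega>"
proof -
  have "max (dev_T J \<omega> / dev (v J) l) (dev_z J \<omega> / dev (card J) l) \<le> max_dev \<omega>"
    unfolding max_dev_def using assms diffs(1) by (intro Max_ge) auto
  thus "dev_T J \<omega> / dev (v J) l \<le> max_dev \<omega>" "dev_z J \<omega> / dev (card J) l \<le> max_dev \<omega>" by auto
qed

lemma max_dev_nonneg: "max_dev \<omega> \<ge> 0"
proof -
  obtain J where J: "J \<in> diff_sets \<C>" using diff_sets_nonempty by auto
  have "0 \<le> dev_T J \<omega> / dev (v J) l"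
    using dev_nonneg[OF v_nonneg l_nonneg] by (simp add: dev_T_def)
  with max_dev_ge[OF J, of \<omega>] show ?thesis by linarith
qed

text \<open>A union bound over at most \<open>exp (2 * l)\<close> set differences, each with two
  two-sided deviations, hence the 4. The summand 2 in the threshold cancels the number of
  differences, and \<open>l \<ge> ln 2\<close> makes the bound the same for all families.\<close>

lemma max_dev_tail:
  assumes card: "card \<C> \<ge> 2" and y: "y \<ge> 0"
  shows "prob {\<omega>\<in>space M. max_dev \<omega> > 2 + y / ln 2} \<le> 4 * exp (- y)"
proof -
  define K where "K = 2 + y / ln 2"
  have K: "K \<ge> 2" using y by (simp add: K_def)
  have l: "l \<ge> ln 2" using card by (simp add: l_def)
  hence l0: "l > 0" by (rule less_le_trans[rotated]) simp
  let ?A = "\<lambda>J. {\<omega>\<in>space M. dev_T J \<omega> \<ge> dev (v J) (K * l)}"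
  let ?B = "\<lambda>J. {\<omega>\<in>space M. dev_z J \<omega> \<ge> dev (card J) (K * l)}"
  \<comment> \<open>As \<open>K\<close> is at least 1, \<open>sqrt K \<le> K\<close>; hence a
    normalised deviation above \<open>K\<close> forces a deviation at level \<open>K * l\<close>,
    where the concentration bound applies.\<close>
  have scale: "dev u (K * l) \<le> K * dev u l" if "u \<ge> 0" for u
  proof -
    have "sqrt K \<le> K" using K by (intro real_le_lsqrt) (auto simp: power2_eq_square)
    hence "sqrt K * sqrt (u * l) \<le> K * sqrt (u * l)" using that l0 by (intro mult_right_mono) auto
    thus ?thesis using that by (simp add: dev_def real_sqrt_mult algebra_simps)
  qed
  have sub': "{\<omega>\<in>space M. max_dev \<omega> > K} \<subseteq> (\<Union>J\<in>diff_sets \<C>. ?A J \<union> ?B J)"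
  proof
    fix \<omega> assume \<omega>: "\<omega> \<in> {\<omega>\<in>space M. max_dev \<omega> > K}"
    have "max_dev \<omega> \<in> (\<lambda>J. max (dev_T J \<omega> / dev (v J) l) (dev_z J \<omega> / dev (card J) l)) ` diff_sets \<C>"
      unfolding max_dev_def using diffs(1) diff_sets_nonempty by (intro Max_in) auto
    then obtain J where J: "J \<in> diff_sets \<C>"
      "max_dev \<omega> = max (dev_T J \<omega> / dev (v J) l) (dev_z J \<omega> / dev (card J) l)" by auto
    hence "K < dev_T J \<omega> / dev (v J) l \<or> K < dev_z J \<omega> / dev (card J) l"
      using \<omega> by (auto simp: max_def split: if_splits)
    hence "K * dev (v J) l < dev_T J \<omega> \<or> K * dev (card J) l < dev_z J \<omega>"
      using dev_pos[OF card v_nonneg] dev_pos[OF card, of "card J"] by (simp add: pos_less_divide_eq)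
    hence "dev (v J) (K * l) \<le> dev_T J \<omega> \<or> dev (card J) (K * l) \<le> dev_z J \<omega>"
      using scale[OF v_nonneg, of J] scale[of "card J"] by auto
    thus "\<omega> \<in> (\<Union>J\<in>diff_sets \<C>. ?A J \<union> ?B J)" using J \<omega> by auto
  qed
  have meas: "?A J \<in> events" "?B J \<in> events" if "J \<in> diff_sets \<C>" for J
    using dev_T_measurable[OF that] dev_z_measurable[OF that] by measurable
  have each: "prob (?A J \<union> ?B J) \<le> 4 * exp (- (K * l))" if J: "J \<in> diff_sets \<C>" for J
  proof -
    have JJ: "finite J" "J \<subseteq> {1..n}" using diffs(3)[OF J] by (auto intro: finite_subset)
    have Kl: "K * l > 0" using K l0 by simp
    have A: "prob (?A J) \<le> 2 * exp (- (K * l))"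
      unfolding dev_T_def v_def using JJ Kl
      by (intro shifted_squares_concentration z_indep z_distributed) auto
    \<comment> \<open>The noise sum is the case of zero shift.\<close>
    have "prob {\<omega>\<in>space M. \<bar>(\<Sum>i\<in>J. (z i \<omega> + 0)\<^sup>2) - (real (card J) + (\<Sum>i\<in>J. 0\<^sup>2))\<bar>
        \<ge> dev (real (card J) + (\<Sum>i\<in>J. 0\<^sup>2)) (K * l)} \<le> 2 * exp (- (K * l))"
      using JJ Kl by (intro shifted_squares_concentration z_indep z_distributed) auto
    hence B: "prob (?B J) \<le> 2 * exp (- (K * l))" by (simp add: dev_z_def)
    have "prob (?A J \<union> ?B J) \<le> prob (?A J) + prob (?B J)"
      using meas[OF J] by (intro measure_Un_le)
    with A B show ?thesis by linarith
  qed
  have "prob {\<omega>\<in>space M. max_dev \<omega> > K} \<le> prob (\<Union>J\<in>diff_sets \<C>. ?A J \<union> ?B J)"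
    using sub' meas diffs(1) by (intro finite_measure_mono sets.finite_UN sets.Un) auto
  also have "\<dots> \<le> (\<Sum>J\<in>diff_sets \<C>. prob (?A J \<union> ?B J))"
    using meas diffs(1) by (intro measure_UNION_le sets.Un) auto
  also have "\<dots> \<le> (\<Sum>J\<in>diff_sets \<C>. 4 * exp (- (K * l)))" by (intro sum_mono each)
  also have "\<dots> = real (card (diff_sets \<C>)) * (4 * exp (- (K * l)))" by simp
  also have "\<dots> \<le> real ((card \<C>)\<^sup>2) * (4 * exp (- (K * l)))"
    using diffs(2) by (intro mult_right_mono) (auto simp del: of_nat_power)
  also have "real ((card \<C>)\<^sup>2) = exp (2 * l)" using card by (simp add: l_def exp_double)
  also have "exp (2 * l) * (4 * exp (- (K * l))) = 4 * exp (- (y / ln 2 * l))"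
    by (simp add: K_def exp_add[symmetric] algebra_simps)
  also have "\<dots> \<le> 4 * exp (- y)"
  proof -
    have "y = y / ln 2 * ln 2" by simp
    also have "\<dots> \<le> y / ln 2 * l" using l y by (intro mult_left_mono) auto
    finally show ?thesis by simp
  qed
  finally show ?thesis by (simp add: K_def)
qed

section \<open>Losses, risks and their oracle inequalities in the model\<close>

lemma X_measurable: "i \<in> {1..n} \<Longrightarrow> X i \<in> borel_measurable M"
  using distributed_measurable[OF \<epsilon>, of i] by (subst measurable_cong[where g = "\<lambda>\<omega>. \<theta> i + \<epsilon> i \<omega>"]) (auto simp: X)

lemma loss_measurable:
  assumes "C \<in> \<C>"
  shows "(\<lambda>\<omega>. loss n \<theta> (\<lambda>i. X i \<omega>) C) \<in> borel_measurable M"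
proof -
  have C: "C \<subseteq> {1..n}" using assms sub by auto
  show ?thesis
    unfolding loss_eq[OF C] using C
    by (intro borel_measurable_add borel_measurable_sum borel_measurable_power borel_measurable_diff
        X_measurable borel_measurable_const) auto
qed

lemma risk_eq:
  assumes "C \<in> \<C>"
  shows "risk M n \<theta> X C = (\<Sum>i\<in>{1..n} - C. (\<theta> i)\<^sup>2) + real (card C) * \<sigma>\<^sup>2"
proof -
  have C: "C \<subseteq> {1..n}" using assms sub by auto
  have sq: "integrable M (\<lambda>\<omega>. (\<epsilon> i \<omega>)\<^sup>2) \<and> (\<integral>\<omega>. (\<epsilon> i \<omega>)\<^sup>2 \<partial>M) = \<sigma>\<^sup>2" if "i \<in> {1..n}" for i
  proof
    have "integrable lborel (\<lambda>x. normal_density 0 \<sigma> x * (x - 0) ^ 2)"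
      using integrable_normal_moment[OF \<sigma>, of 0 2] by simp
    thus "integrable M (\<lambda>\<omega>. (\<epsilon> i \<omega>)\<^sup>2)"
      using distributed_integrable[OF \<epsilon>[OF that], of "\<lambda>x. x\<^sup>2"] by simp
    show "(\<integral>\<omega>. (\<epsilon> i \<omega>)\<^sup>2 \<partial>M) = \<sigma>\<^sup>2"
      using normal_distributed_variance[OF \<sigma> \<epsilon>[OF that]] normal_distributed_expectation[OF \<sigma> \<epsilon>[OF that]] by simp
  qed
  have "risk M n \<theta> X C = (\<integral>\<omega>. (\<Sum>i\<in>{1..n} - C. (\<theta> i)\<^sup>2) + (\<Sum>i\<in>C. (\<epsilon> i \<omega>)\<^sup>2) \<partial>M)"
    unfolding risk_def loss_eq[OF C] using C
    by (intro Bochner_Integration.integral_cong) (auto intro!: sum.cong simp: X subset_iff)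
  also have "\<dots> = (\<Sum>i\<in>{1..n} - C. (\<theta> i)\<^sup>2) + (\<Sum>i\<in>C. \<integral>\<omega>. (\<epsilon> i \<omega>)\<^sup>2 \<partial>M)"
    using C sq by (subst Bochner_Integration.integral_add)
      (auto simp: prob_space intro!: Bochner_Integration.integrable_sum Bochner_Integration.integral_sum)
  also have "(\<Sum>i\<in>C. \<integral>\<omega>. (\<epsilon> i \<omega>)\<^sup>2 \<partial>M) = (\<Sum>i\<in>C. \<sigma>\<^sup>2)"
    using C sq by (intro sum.cong) auto
  finally show ?thesis by simp
qed

lemma risk_eq_wloss: "C \<in> \<C> \<Longrightarrow> risk M n \<theta> X C = \<sigma>\<^sup>2 * wloss n t (\<lambda>_. 1) C"
  using \<sigma> by (simp add: risk_eq wloss_def t_def power_divide sum_divide_distrib[symmetric] field_simps)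

lemma loss_eq_wloss:
  assumes "C \<in> \<C>"
  shows "loss n \<theta> (\<lambda>i. X i \<omega>) C = \<sigma>\<^sup>2 * wloss n t (\<lambda>i. ((X i \<omega> - \<theta> i) / \<sigma>)\<^sup>2) C"
proof -
  have "C \<subseteq> {1..n}" using assms sub by auto
  thus ?thesis
    using \<sigma> by (simp add: loss_eq wloss_def t_def power_divide sum_divide_distrib[symmetric] field_simps)
qed

text \<open>The exponent 1 makes both remainder terms instances of \<open>big_Op_power_mult\<close>.\<close>

lemma oracle_inequality:
  assumes \<alpha>: "0 < \<alpha>" "\<alpha> < 1" and \<omega>: "\<omega> \<in> space M" and w: "\<And>i. w i \<ge> 0"
    and W: "\<And>J. J \<in> diff_sets \<C> \<Longrightarrow> \<bar>(\<Sum>i\<in>J. w i) - real (card J)\<bar> \<le> dev_z J \<omega>"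
    and C: "C \<in> conf_region \<alpha> \<sigma> \<C> (\<lambda>i. X i \<omega>)" and D: "D \<in> \<C>"
  defines "G \<equiv> \<lambda>C. \<sigma>\<^sup>2 * wloss n t w C"
  shows "G C \<le> G D + oracle_const * (level_factor \<alpha> + max_dev \<omega>) ^ 1 * sqrt (\<sigma>\<^sup>2 * l * G D)
    + oracle_const * (level_factor \<alpha> + max_dev \<omega>)\<^sup>2 * (\<sigma>\<^sup>2 * l)"
proof (cases "card \<C> \<ge> 2")
  \<comment> \<open>With a single candidate the logarithm is 0, so both remainders vanish and the
    two sides coincide.\<close>
  case False
  have "C \<in> \<C>" using C by (simp add: conf_region_def)
  hence "C = D" using False fin D card_le_Suc0_iff_eq[OF fin] by auto
  moreover have "l = 0" using False nonempty fin by (auto simp: l_def not_le less_2_cases_iff)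
  ultimately show ?thesis by simp
next
  case True
  let ?K = "level_factor \<alpha> + max_dev \<omega>"
  \<comment> \<open>\<open>?K\<close> dominates both the level factor and \<open>max_dev\<close>, so
    this \<open>L\<close> serves the Bonferroni level and, by \<open>dev_scale\<close>, all
    deviations.\<close>
  define L where "L = ?K\<^sup>2 * l"
  have l: "l > 0" using True by (simp add: l_def)
  have K: "?K \<ge> 2" "?K \<ge> level_factor \<alpha>" "max_dev \<omega> \<le> ?K"
    using level_factor_ge[OF \<alpha>] max_dev_nonneg[of \<omega>] by auto
  have "?K \<le> ?K\<^sup>2" using K(1) by (intro self_le_power) auto
  with K(2) have "level_factor \<alpha> \<le> ?K\<^sup>2" by (rule order_trans)
  hence L: "L \<ge> level_factor \<alpha> * l" "L > 0" using l K by (auto simp: L_def)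
  have dev_T: "dev_T J \<omega> \<le> dev (v J) L" if "J \<in> diff_sets \<C>" for J
  proof -
    have "dev_T J \<omega> \<le> max_dev \<omega> * dev (v J) l"
      using max_dev_ge(1)[OF that, of \<omega>] dev_pos[OF True v_nonneg, of J] by (simp add: pos_divide_le_eq)
    also have "\<dots> \<le> dev (v J) L" unfolding L_def using K l v_nonneg by (intro dev_scale) auto
    finally show ?thesis .
  qed
  have dev_z: "dev_z J \<omega> \<le> dev (card J) L" if "J \<in> diff_sets \<C>" for J
  proof -
    have "dev_z J \<omega> \<le> max_dev \<omega> * dev (card J) l"
      using max_dev_ge(2)[OF that, of \<omega>] dev_pos[OF True, of "card J"] by (simp add: pos_divide_le_eq)
    also have "\<dots> \<le> dev (card J) L" unfolding L_def using K l by (intro dev_scale) auto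
    finally show ?thesis .
  qed
  have T: "T_stat \<sigma> (\<lambda>i. X i \<omega>) J = (\<Sum>i\<in>J. (z i \<omega> + t i)\<^sup>2)" if "J \<in> diff_sets \<C>" for J
    unfolding T_stat_def sum_divide_distrib using diffs(3)[OF that] \<omega>
    by (intro sum.cong) (auto simp: X z_def t_def power_divide[symmetric] add_divide_distrib add.commute subset_iff)
  have p: "\<alpha> / (2 * real (num_diff \<C>)) < 1"
    using \<alpha> num_diff_pos[OF fin True sub] by (simp add: pos_divide_less_eq)
  have wl: "wloss n t w C \<le> wloss n t w D + oracle_const * (sqrt (wloss n t w D * L) + L)"
    unfolding oracle_const_def
  proof (rule wloss_oracle[OF sub w L(2) _ p C D])
    show "exp (- L) < \<alpha> / (2 * real (num_diff \<C>))"
      using exp_level_factor_less[OF \<alpha> fin True sub] L(1) by (simp add: l_def)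
    fix J assume J: "J \<in> diff_sets \<C>"
    show "\<bar>T_stat \<sigma> (\<lambda>i. X i \<omega>) J - (real (card J) + (\<Sum>i\<in>J. (t i)\<^sup>2))\<bar>
        \<le> dev (real (card J) + (\<Sum>i\<in>J. (t i)\<^sup>2)) L"
      using dev_T[OF J] unfolding T[OF J] dev_T_def v_def .
    show "\<bar>(\<Sum>i\<in>J. w i) - real (card J)\<bar> \<le> dev (real (card J)) L"
      using W[OF J] dev_z[OF J] by linarith
  qed
  \<comment> \<open>\<open>L\<close> enters once under a root and once linearly, hence the first and
    the second power of \<open>?K\<close>.\<close>
  have "\<sigma>\<^sup>2 * sqrt (wloss n t w D * L) = ?K * sqrt (\<sigma>\<^sup>2 * l * G D)"
  proof -
    have "sqrt (\<sigma>\<^sup>2 * l * G D) = sqrt ((\<sigma>\<^sup>2)\<^sup>2 * (wloss n t w D * l))"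
      by (simp add: G_def power2_eq_square mult_ac)
    also have "\<dots> = \<sigma>\<^sup>2 * sqrt (wloss n t w D * l)" by (simp only: real_sqrt_mult real_sqrt_abs abs_power2)
    finally show ?thesis using K by (auto simp: L_def real_sqrt_mult)
  qed
  hence "G D + oracle_const * ?K ^ 1 * sqrt (\<sigma>\<^sup>2 * l * G D) + oracle_const * ?K\<^sup>2 * (\<sigma>\<^sup>2 * l)
      = \<sigma>\<^sup>2 * (wloss n t w D + oracle_const * (sqrt (wloss n t w D * L) + L))"
    by (simp add: G_def L_def algebra_simps)
  with mult_left_mono[OF wl, of "\<sigma>\<^sup>2"] show ?thesis by (simp add: G_def)
qed

text \<open>With unit weights the noise sums equal the cardinalities, so the condition on the
  weights is trivial.\<close>

lemma risk_oracle_inequality: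
  assumes "0 < \<alpha>" "\<alpha> < 1" "\<omega> \<in> space M" "C \<in> conf_region \<alpha> \<sigma> \<C> (\<lambda>i. X i \<omega>)" "D \<in> \<C>"
  shows "risk M n \<theta> X C \<le> risk M n \<theta> X D + oracle_const * (level_factor \<alpha> + max_dev \<omega>) ^ 1 * sqrt (\<sigma>\<^sup>2 * l * risk M n \<theta> X D)
    + oracle_const * (level_factor \<alpha> + max_dev \<omega>)\<^sup>2 * (\<sigma>\<^sup>2 * l)"
proof -
  have "C \<in> \<C>" using assms by (simp add: conf_region_def)
  thus ?thesis unfolding risk_eq_wloss[OF \<open>C \<in> \<C>\<close>] risk_eq_wloss[OF assms(5)]
    using assms by (intro oracle_inequality) (auto simp: dev_z_def)
qed

text \<open>The weights are the squared standardised noise variables, whose deviation is exactly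
  \<open>dev_z\<close>.\<close>

lemma loss_oracle_inequality:
  assumes "0 < \<alpha>" "\<alpha> < 1" "\<omega> \<in> space M" "C \<in> conf_region \<alpha> \<sigma> \<C> (\<lambda>i. X i \<omega>)" "D \<in> \<C>"
  defines "G \<equiv> loss n \<theta> (\<lambda>i. X i \<omega>)"
  shows "G C \<le> G D + oracle_const * (level_factor \<alpha> + max_dev \<omega>) ^ 1 * sqrt (\<sigma>\<^sup>2 * l * G D)
    + oracle_const * (level_factor \<alpha> + max_dev \<omega>)\<^sup>2 * (\<sigma>\<^sup>2 * l)"
proof -
  have "C \<in> \<C>" using assms by (simp add: conf_region_def)
  moreover have "(\<Sum>i\<in>J. ((X i \<omega> - \<theta> i) / \<sigma>)\<^sup>2) = (\<Sum>i\<in>J. (z i \<omega>)\<^sup>2)" if "J \<in> diff_sets \<C>" for J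
    using diffs(3)[OF that] assms(3) by (intro sum.cong) (auto simp: X z_def subset_iff)
  ultimately show ?thesis unfolding G_def loss_eq_wloss[OF \<open>C \<in> \<C>\<close>] loss_eq_wloss[OF assms(5)]
    using assms by (intro oracle_inequality) (auto simp: dev_z_def)
qed

end

section \<open>Passage to bounds in probability\<close>

lemma Max_le_Min_bound:
  fixes G :: "'b \<Rightarrow> real"
  assumes "finite \<C>" "\<C> \<noteq> {}" "\<K> \<subseteq> \<C>" "\<K> \<noteq> {}"
    and "\<And>C D. C \<in> \<K> \<Longrightarrow> D \<in> \<C> \<Longrightarrow> G C \<le> G D + a * sqrt (s * G D) + b"
  shows "(MAX C\<in>\<K>. G C) \<le> (MIN D\<in>\<C>. G D) + a * sqrt (s * (MIN D\<in>\<C>. G D)) + b"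
proof -
  have "(MIN D\<in>\<C>. G D) \<in> G ` \<C>" using assms by (intro Min_in) auto
  then obtain D where D: "D \<in> \<C>" "(MIN D\<in>\<C>. G D) = G D" by auto
  have "finite \<K>" using assms(1,3) by (rule finite_subset[rotated])
  thus ?thesis unfolding D(2) using assms D(1) by (intro Max.boundedI) auto
qed

text \<open>On the event \<open>Z n \<omega> \<le> y\<close> the factor is at most its value at
  \<open>y\<close>, which serves as the constant in \<open>big_Op\<close>. Where the rate vanishes
  identically the product does too; this alternative in \<open>tail\<close> serves one-member
  families.\<close>

lemma big_Op_power_mult:
  fixes Z r :: "nat \<Rightarrow> 'a \<Rightarrow> real"
  assumes Z: "\<And>n. Z n \<in> borel_measurable (M n)" "\<And>n \<omega>. 0 \<le> Z n \<omega>"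
    and r: "\<And>n. r n \<in> borel_measurable (M n)"
    and fin: "\<And>n. finite_measure (M n)"
    and nn: "b \<ge> 0" "c \<ge> 0"
    and tail: "\<And>e. e > 0 \<Longrightarrow> \<exists>y. \<forall>n. (\<forall>\<omega>. r n \<omega> = 0) \<or> measure (M n) {\<omega>\<in>space (M n). Z n \<omega> > y} < e"
  shows "big_Op M (\<lambda>n \<omega>. b * (c + Z n \<omega>) ^ m * r n \<omega>) r"
  unfolding big_Op_def
proof (intro conjI allI impI)
  show "(\<lambda>\<omega>. b * (c + Z n \<omega>) ^ m * r n \<omega>) \<in> borel_measurable (M n)" "r n \<in> borel_measurable (M n)" for n
    using Z(1) r by auto
  fix e :: real assume e: "e > 0"
  from tail[OF e] obtain y where y: "\<And>n. (\<forall>\<omega>. r n \<omega> = 0) \<or> measure (M n) {\<omega>\<in>space (M n). Z n \<omega> > y} < e"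
    by blast
  have "measure (M n) {\<omega>\<in>space (M n). b * (c + y) ^ m * \<bar>r n \<omega>\<bar> < \<bar>b * (c + Z n \<omega>) ^ m * r n \<omega>\<bar>} < e"
    (is "measure _ ?A < e") for n
  proof (cases "\<forall>\<omega>. r n \<omega> = 0")
    case True
    thus ?thesis using e by simp
  next
    case False
    interpret finite_measure "M n" by (rule fin)
    have "Z n \<omega> > y" if "b * (c + y) ^ m * \<bar>r n \<omega>\<bar> < \<bar>b * (c + Z n \<omega>) ^ m * r n \<omega>\<bar>" for \<omega>
    proof (rule ccontr)
      assume "\<not> Z n \<omega> > y"
      hence "(c + Z n \<omega>) ^ m \<le> (c + y) ^ m" using nn Z(2)[of n \<omega>] by (intro power_mono) auto
      hence "b * (c + Z n \<omega>) ^ m * \<bar>r n \<omega>\<bar> \<le> b * (c + y) ^ m * \<bar>r n \<omega>\<bar>"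
        using nn by (intro mult_right_mono mult_left_mono) auto
      with that nn Z(2)[of n \<omega>] show False by (simp add: abs_mult)
    qed
    hence "measure (M n) ?A \<le> measure (M n) {\<omega>\<in>space (M n). Z n \<omega> > y}"
      using Z(1)[of n] by (intro finite_measure_mono) auto
    with y[of n] False show ?thesis by auto
  qed
  thus "\<exists>K. \<forall>\<^sub>F n in sequentially.
      measure (M n) {\<omega>\<in>space (M n). K * \<bar>r n \<omega>\<bar> < \<bar>b * (c + Z n \<omega>) ^ m * r n \<omega>\<bar>} < e"
    by (intro exI[of _ "b * (c + y) ^ m"] always_eventually allI)
qed

theorem theorem4:
  fixes M :: "nat \<Rightarrow> 'a measure"
    and X \<epsilon> :: "nat \<Rightarrow> nat \<Rightarrow> 'a \<Rightarrow> real"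
    and \<theta> :: "nat \<Rightarrow> nat \<Rightarrow> real"
    and \<C> :: "nat \<Rightarrow> nat set set"
    and \<sigma> \<alpha> :: real
  assumes "\<sigma> > 0"
    and "0 < \<alpha>" and "\<alpha> < 1"
    and "\<And>n. prob_space (M n)"
    and "\<And>n. prob_space.indep_vars (M n) (\<lambda>_. borel) (\<epsilon> n) {1..n}"
    and "\<And>n i. i \<in> {1..n} \<Longrightarrow> distributed (M n) lborel (\<epsilon> n i) (normal_density 0 \<sigma>)"
    and "\<And>n i \<omega>. i \<in> {1..n} \<Longrightarrow> \<omega> \<in> space (M n) \<Longrightarrow> X n i \<omega> = \<theta> n i + \<epsilon> n i \<omega>"
    and "\<And>n. \<C> n \<noteq> {}"
    and "\<And>n. \<C> n \<subseteq> Pow {1..n}"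
    and "(\<lambda>n. ln (real (card (\<C> n)))) \<in> o(\<lambda>n. real n)"
  shows
    "(\<exists>U V.
        big_Op M U (\<lambda>n \<omega>. sqrt (\<sigma>\<^sup>2 * ln (real (card (\<C> n))) * (MIN D\<in>\<C> n. risk (M n) n (\<theta> n) (X n) D))) \<and>
        big_Op M V (\<lambda>n \<omega>. \<sigma>\<^sup>2 * ln (real (card (\<C> n)))) \<and>
        (\<forall>n. \<forall>\<omega>\<in>space (M n). conf_region \<alpha> \<sigma> (\<C> n) (\<lambda>i. X n i \<omega>) \<noteq> {} \<longrightarrow>
           (MAX C\<in>conf_region \<alpha> \<sigma> (\<C> n) (\<lambda>i. X n i \<omega>). risk (M n) n (\<theta> n) (X n) C)
           \<le> (MIN D\<in>\<C> n. risk (M n) n (\<theta> n) (X n) D) + U n \<omega> + V n \<omega>)) \<and>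
     (\<exists>U V.
        big_Op M U (\<lambda>n \<omega>. sqrt (\<sigma>\<^sup>2 * ln (real (card (\<C> n))) * (MIN D\<in>\<C> n. loss n (\<theta> n) (\<lambda>i. X n i \<omega>) D))) \<and>
        big_Op M V (\<lambda>n \<omega>. \<sigma>\<^sup>2 * ln (real (card (\<C> n)))) \<and>
        (\<forall>n. \<forall>\<omega>\<in>space (M n). conf_region \<alpha> \<sigma> (\<C> n) (\<lambda>i. X n i \<omega>) \<noteq> {} \<longrightarrow>
           (MAX C\<in>conf_region \<alpha> \<sigma> (\<C> n) (\<lambda>i. X n i \<omega>). loss n (\<theta> n) (\<lambda>i. X n i \<omega>) C)
           \<le> (MIN D\<in>\<C> n. loss n (\<theta> n) (\<lambda>i. X n i \<omega>) D) + U n \<omega> + V n \<omega>))"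
proof -
  note \<sigma> = assms(1) and \<alpha> = assms(2,3) and nonempty = assms(8)
  have model: "gaussian_sequence (M n) n (\<theta> n) \<sigma> (\<epsilon> n) (X n) (\<C> n)" for n
    using assms by (intro gaussian_sequence.intro gaussian_sequence_axioms.intro) auto
  note fin = gaussian_sequence.fin[OF model] and l_eq = gaussian_sequence.l_def[OF model]
  let ?Z = "\<lambda>n. gaussian_sequence.max_dev (\<theta> n) \<sigma> (\<epsilon> n) (\<C> n)"
  let ?c = "level_factor \<alpha>"
  let ?b = oracle_const
  have c: "?c \<ge> 0" using level_factor_ge[OF \<alpha>] by simp
  have tail: "\<exists>y. \<forall>n. card (\<C> n) < 2 \<or> measure (M n) {\<omega>\<in>space (M n). ?Z n \<omega> > y} < e"
    if e: "e > 0" for e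
  proof -
    \<comment> \<open>The 8 leaves \<open>4 * exp (- y)\<close> at most \<open>e / 2\<close>; the
      maximum makes \<open>y\<close> nonnegative, as the tail bound requires.\<close>
    define y where "y = max 0 (ln (8 / e))"
    have "4 * exp (- y) \<le> 4 * exp (- ln (8 / e))" by (simp add: y_def)
    also have "\<dots> < e" using e by (simp add: exp_minus)
    finally have y: "4 * exp (- y) < e" .
    have y0: "y \<ge> 0" by (simp add: y_def)
    have "measure (M n) {\<omega>\<in>space (M n). ?Z n \<omega> > 2 + y / ln 2} < e" if "\<not> card (\<C> n) < 2" for n
      using gaussian_sequence.max_dev_tail[OF model _ y0] y that by (meson le_less_trans not_less)
    thus ?thesis by blast
  qed
  have ln0: "ln (real (card (\<C> n))) = 0" if "card (\<C> n) < 2" for n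
    using that fin[of n] nonempty[of n] by (auto simp: less_2_cases_iff)
  have Op: "big_Op M (\<lambda>n \<omega>. ?b * (?c + ?Z n \<omega>) ^ m * r n \<omega>) r"
    if "\<And>n. r n \<in> borel_measurable (M n)" "\<And>n \<omega>. card (\<C> n) < 2 \<Longrightarrow> r n \<omega> = 0" for m r
  proof (rule big_Op_power_mult)
    show "finite_measure (M n)" for n using assms(4) by (simp add: prob_space.axioms)
    show "\<exists>y. \<forall>n. (\<forall>\<omega>. r n \<omega> = 0) \<or> measure (M n) {\<omega>\<in>space (M n). ?Z n \<omega> > y} < e" if "e > 0" for e
      using tail[OF that] \<open>\<And>n \<omega>. card (\<C> n) < 2 \<Longrightarrow> r n \<omega> = 0\<close> by metis
  qed (use that c gaussian_sequence.max_dev_measurable[OF model] gaussian_sequence.max_dev_nonneg[OF model]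
      oracle_const_nonneg in auto)
  have V: "big_Op M (\<lambda>n \<omega>. ?b * (?c + ?Z n \<omega>)\<^sup>2 * (\<sigma>\<^sup>2 * ln (real (card (\<C> n)))))
      (\<lambda>n \<omega>. \<sigma>\<^sup>2 * ln (real (card (\<C> n))))"
    by (rule Op) (simp_all add: ln0)
  have region: "conf_region \<alpha> \<sigma> (\<C> n) x \<subseteq> \<C> n" for n x by (auto simp: conf_region_def)
  show ?thesis
  \<comment> \<open>The witnesses are powers of one random factor, scaled by a constant, times the
    respective rate; \<open>V\<close> is common to risk and loss.\<close>
  proof (intro conjI exI allI impI ballI)
    show "big_Op M (\<lambda>n \<omega>. ?b * (?c + ?Z n \<omega>) ^ 1 *
        sqrt (\<sigma>\<^sup>2 * ln (real (card (\<C> n))) * (MIN D\<in>\<C> n. risk (M n) n (\<theta> n) (X n) D)))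
      (\<lambda>n \<omega>. sqrt (\<sigma>\<^sup>2 * ln (real (card (\<C> n))) * (MIN D\<in>\<C> n. risk (M n) n (\<theta> n) (X n) D)))"
      by (rule Op) (simp_all add: ln0)
    show "big_Op M (\<lambda>n \<omega>. ?b * (?c + ?Z n \<omega>) ^ 1 *
        sqrt (\<sigma>\<^sup>2 * ln (real (card (\<C> n))) * (MIN D\<in>\<C> n. loss n (\<theta> n) (\<lambda>i. X n i \<omega>) D)))
      (\<lambda>n \<omega>. sqrt (\<sigma>\<^sup>2 * ln (real (card (\<C> n))) * (MIN D\<in>\<C> n. loss n (\<theta> n) (\<lambda>i. X n i \<omega>) D)))"
    \<comment> \<open>Here the rate is itself random, so its measurability rests on that of the
      losses.\<close>
    proof (rule Op)
      show "(\<lambda>\<omega>. sqrt (\<sigma>\<^sup>2 * ln (real (card (\<C> n))) * (MIN D\<in>\<C> n. loss n (\<theta> n) (\<lambda>i. X n i \<omega>) D)))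
          \<in> borel_measurable (M n)" for n
      proof -
        have [measurable]: "(\<lambda>\<omega>. MIN D\<in>\<C> n. loss n (\<theta> n) (\<lambda>i. X n i \<omega>) D) \<in> borel_measurable (M n)"
          by (intro borel_measurable_Min fin gaussian_sequence.loss_measurable[OF model])
        show ?thesis by measurable
      qed
    qed (simp add: ln0)
    fix n \<omega> assume \<omega>: "\<omega> \<in> space (M n)" and ne: "conf_region \<alpha> \<sigma> (\<C> n) (\<lambda>i. X n i \<omega>) \<noteq> {}"
    show "(MAX C\<in>conf_region \<alpha> \<sigma> (\<C> n) (\<lambda>i. X n i \<omega>). risk (M n) n (\<theta> n) (X n) C)
        \<le> (MIN D\<in>\<C> n. risk (M n) n (\<theta> n) (X n) D)
          + ?b * (?c + ?Z n \<omega>) ^ 1 * sqrt (\<sigma>\<^sup>2 * ln (real (card (\<C> n))) * (MIN D\<in>\<C> n. risk (M n) n (\<theta> n) (X n) D))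
          + ?b * (?c + ?Z n \<omega>)\<^sup>2 * (\<sigma>\<^sup>2 * ln (real (card (\<C> n))))"
      using gaussian_sequence.risk_oracle_inequality[OF model \<alpha> \<omega>]
      by (intro Max_le_Min_bound fin nonempty region ne) (simp add: l_eq)
    show "(MAX C\<in>conf_region \<alpha> \<sigma> (\<C> n) (\<lambda>i. X n i \<omega>). loss n (\<theta> n) (\<lambda>i. X n i \<omega>) C)
        \<le> (MIN D\<in>\<C> n. loss n (\<theta> n) (\<lambda>i. X n i \<omega>) D)
          + ?b * (?c + ?Z n \<omega>) ^ 1 * sqrt (\<sigma>\<^sup>2 * ln (real (card (\<C> n))) * (MIN D\<in>\<C> n. loss n (\<theta> n) (\<lambda>i. X n i \<omega>) D))
          + ?b * (?c + ?Z n \<omega>)\<^sup>2 * (\<sigma>\<^sup>2 * ln (real (card (\<C> n))))"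
      using gaussian_sequence.loss_oracle_inequality[OF model \<alpha> \<omega>]
      by (intro Max_le_Min_bound fin nonempty region ne) (simp add: l_eq)
  qed (rule V)+
qed

end
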